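(* Let $\nu$ be a probability distribution on $\mathbb{R}$ with zero mean and unit variance such that $\varphi(\theta) := \int_{\mathbb{R}} e^{\theta x}\,\nu(\mathrm{d}x) < \infty$ for some $\theta > 0$, let $\theta_\star \in (0,\infty]$ be the supremum of all such $\theta > 0$, and for $\theta \in [0,\theta_\star)$ let $f_\theta(x) = \exp\{\theta x - \log\varphi(\theta)\}$, a probability density with respect to $\nu$. Consider a sequence of problems (the index of the sequence being omitted, $\nu$ being fixed) with positive integers $M, N$, $m \le M$, $n \le N$, a number $\theta_\ddag > 0$, an index set $\mathcal{S}_{\rm true} = \mathcal{I}_{\rm true}\times\mathcal{J}_{\rm true}$ with $\mathcal{I}_{\rm true}\subset[M]$, $|\mathcal{I}_{\rm true}| = m$, $\mathcal{J}_{\rm true}\subset[N]$, $|\mathcal{J}_{\rm true}| = n$, and parameters $\theta_{ij} \in [0,\theta_\star)$, $(i,j)\in[M]\times[N]$, satisfying $\theta_{ij} \ge \theta_\ddag$ for $(i,j)\in\mathcal{S}_{\rm true}$ and $\theta_{ij} = 0$ otherwise. Let $\mathbf{X} = (X_{ij})$ be an $M\times N$ random matrix with independent entries $X_{ij}\sim f_{\theta_{ij}}$. Assume that, along the sequence, $$M, N, m, n \to \infty, \quad \frac{m}{M}\to 0, \quad \frac{n}{N}\to 0, \quad \frac{\log(M\vee N)}{m\wedge n}\to 0, \quad \frac{\log^3(M\vee N)}{m\wedge n}\to 0,$$ and that either (i) $\nu$ has support bounded from above, or (ii) $\max_{i,j}\theta_{ij} \le \bar\theta$ for some fixed $\bar\theta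 < \theta_\star$ (not depending on the index of the sequence). Let the group of permutations $\Pi$ be either $\Pi_1$ (permutations within rows) or $\Pi_2$ (all permutations of the entries); if $\Pi = \Pi_1$, assume in addition that $\varphi(\theta) < \infty$ for some $\theta < 0$. If $$\liminf \frac{\theta_\ddag\sqrt{mn}}{\sqrt{2\left(m\log\frac{M}{m} + n\log\frac{N}{n}\right)}} > 1,$$ then for any fixed level $\alpha > 0$ the permutation scan test has limiting power $1$, that is, $$\mathbb{P}\big(\mathfrak{P}(\mathbf{X}) \le \alpha\big) \to 1,$$ where $\mathfrak{P}(\mathbf{X})$ is the permutation P-value of the scan statistic with respect to $\Pi$.
   Context: Notation: $[K] = \{1,\dots,K\}$, $a\vee b = \max(a,b)$, $a\wedge b = \min(a,b)$, $\log^3 x = (\log x)^3$. Scan statistic: for a real $M\times N$ matrix $\mathbf{X} = (X_{ij})$ and the known submatrix size $m\times n$, $$\mathrm{scan}(\mathbf{X}) = \max_{\mathcal{I}\subset[M],\,|\mathcal{I}|=m}\ \max_{\mathcal{J}\subset[N],\,|\mathcal{J}|=n}\ \sum_{i\in\mathcal{I}}\sum_{j\in\mathcal{J}} X_{ij}.$$ Permutation groups: $\Pi_2$ is the group of all permutations of the index set $[M]\times[N]$ (so $|\Pi_2| = (MN)!$); $\Pi_1$ is the subgroup of those permutations that permute the indices within each row, i.e. that map $\{i\}\times[N]$ to itself for every $i\in[M]$ (so $|\Pi_1| = (N!)^M$). Permutation P-value and test: for $\pi\in\Pi$ let $\mathbf{X}_\pi = (X_{\pi(i,j)})$ be the matrix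 permuted by $\pi$, and $$\mathfrak{P}(\mathbf{X}) = \frac{\#\{\pi\in\Pi : \mathrm{scan}(\mathbf{X}_\pi)\ge\mathrm{scan}(\mathbf{X})\}}{|\Pi|}.$$ The permutation scan test at level $\alpha$ rejects the null hypothesis (all $\theta_{ij} = 0$) when $\mathfrak{P}(\mathbf{X})\le\alpha$. Its power is the probability of rejection under the alternative, i.e. when $\theta_{ij}\ge\theta_\ddag$ on some $m\times n$ submatrix index set $\mathcal{S}_{\rm true}$ and $\theta_{ij}=0$ elsewhere. *)

theory Defs
  imports "HOL-Probability.Probability" "HOL-Combinatorics.Permutations"
begin

definition mgf :: "real measure \<Rightarrow> real \<Rightarrow> ennreal" where
  "mgf \<nu> \<theta> = (\<integral>\<^sup>+ x. ennreal (exp (\<theta> * x)) \<partial>\<nu>)"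

definition theta_star :: "real measure \<Rightarrow> ereal" where
  "theta_star \<nu> = Sup {ereal \<theta> | \<theta>. 0 < \<theta> \<and> mgf \<nu> \<theta> < \<infinity>}"

(* Only meaningful when mgf is finite at theta, since enn2real maps infinity to 0. *)
definition tilt_density :: "real measure \<Rightarrow> real \<Rightarrow> real \<Rightarrow> real" where
  "tilt_density \<nu> \<theta> x = exp (\<theta> * x - ln (enn2real (mgf \<nu> \<theta>)))"

definition measure_support :: "real measure \<Rightarrow> real set" where
  "measure_support \<nu> = {x. \<forall>U. open U \<and> x \<in> U \<longrightarrow> 0 < emeasure \<nu> U}"

(* An M x N matrix is a function on index pairs; only its values on grid M N matter. *)
definition grid :: "nat \<Rightarrow> nat \<Rightarrow> (nat \<times> nat) set" where
  "grid M N = {1..M} \<times> {1..N}"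

definition scan :: "nat \<Rightarrow> nat \<Rightarrow> nat \<Rightarrow> nat \<Rightarrow> (nat \<times> nat \<Rightarrow> real) \<Rightarrow> real" where
  "scan M N m n X =
     (MAX I \<in> {I. I \<subseteq> {1..M} \<and> card I = m}.
        MAX J \<in> {J. J \<subseteq> {1..N} \<and> card J = n}. \<Sum>i\<in>I. \<Sum>j\<in>J. X (i, j))"

definition all_perms :: "nat \<Rightarrow> nat \<Rightarrow> (nat \<times> nat \<Rightarrow> nat \<times> nat) set" where
  "all_perms M N = {p. p permutes grid M N}"

definition row_perms :: "nat \<Rightarrow> nat \<Rightarrow> (nat \<times> nat \<Rightarrow> nat \<times> nat) set" where
  "row_perms M N =
     {p \<in> all_perms M N. \<forall>i\<in>{1..M}. p ` ({i} \<times> {1..N}) = {i} \<times> {1..N}}"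

definition perm_pvalue ::
  "(nat \<times> nat \<Rightarrow> nat \<times> nat) set \<Rightarrow> nat \<Rightarrow> nat \<Rightarrow> nat \<Rightarrow> nat \<Rightarrow> (nat \<times> nat \<Rightarrow> real) \<Rightarrow> real" where
  "perm_pvalue G M N m n X =
     real (card {p \<in> G. scan M N m n (\<lambda>ij. X (p ij)) \<ge> scan M N m n X}) / real (card G)"

end

theory Submission
  imports Defs
begin

text \<open>
  Let \<open>\<tau>\<^sup>2 = 2 (m ln (M/m) + n ln (N/n)) / (m n)\<close>. A union bound over blocks and Markov's inequality
  for \<open>exp (\<tau> \<cdot>)\<close> under a uniform random permutation bound the P-value by
  \<open>(M choose m) (N choose n) exp (- \<tau> \<Sum>\<^bsub>S\<^esub> X)\<close> times the largest permutation average of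
  \<open>exp (\<tau> \<Sum>\<^bsub>I \<times> J\<^esub> X\<^sub>\<pi>)\<close>. By transposition symmetry and the AM-GM inequality, sampling without replacement
  is dominated by sampling with replacement, so that average is at most \<open>exp ((n/N) B)\<close> as soon as
  \<open>\<Sum>\<^bsub>I \<times> [N]\<^esub> (exp (\<tau> X) - 1) \<le> B\<close> for all \<open>I\<close> of size \<open>m\<close>; this holds for both groups.

  With high probability one may take \<open>B = m N \<tau>\<^sup>2 (1/2 + o(1)) + \<tau> \<Sum>\<^bsub>S\<^esub> E X\<close>. For the null entries this is a
  Chernoff bound for \<open>exp (min (\<tau> X) 1) - 1\<close> with a union bound over \<open>I\<close>; the truncation is harmless since
  \<open>\<tau> ln (M \<or> N) \<longrightarrow> 0\<close>, which is where the third power of the logarithm is used. For the anomalous entries,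
  second moments suffice, because a sum over any set of rows is at most the sum of the absolute row
  fluctuations. Since the tilted mean is at least \<open>(1 + \<epsilon>) \<tau>\<close> on \<open>S\<close> and \<open>n/N \<longrightarrow> 0\<close>, the exponent of the
  resulting bound is at most \<open>- c m n \<tau>\<^sup>2 \<longrightarrow> - \<infinity>\<close>.
\<close>

section \<open>Averages over permutations\<close>

text \<open>Composing with the swap of \<open>c\<close> and \<open>d\<close> maps \<open>G\<close>
  onto itself. For \<open>d\<close> outside \<open>S\<close> this turns the factor
  \<open>a (p d)\<close> into \<open>a (p c)\<close>; for \<open>d\<close> in \<open>S\<close> the
  AM-GM inequality is used. Summing over \<open>d \<in> B\<close> replaces the factor at
  \<open>c\<close> by the constant \<open>T\<close>, which expresses the negative dependence of
  sampling without replacement.\<close>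

lemma sum_prod_insert_le:
  fixes a :: "'b \<Rightarrow> real" and G :: "('c \<Rightarrow> 'b) set"
  assumes "finite S" "c \<notin> S" "c \<in> B"
    and nonneg: "\<And>x. 0 \<le> a x"
    and closed: "\<And>d p. d \<in> B \<Longrightarrow> p \<in> G \<Longrightarrow> p \<circ> Transposition.transpose c d \<in> G"
    and total: "\<And>p. p \<in> G \<Longrightarrow> (\<Sum>d\<in>B. a (p d)) = T"
  shows "real (card B) * (\<Sum>p\<in>G. \<Prod>x\<in>insert c S. a (p x)) \<le> T * (\<Sum>p\<in>G. \<Prod>x\<in>S. a (p x))"
proof -
  have reindex: "(\<Sum>p\<in>G. f p) = (\<Sum>p\<in>G. f (p \<circ> Transposition.transpose c d))"
    if "d \<in> B" for d and f :: "_ \<Rightarrow> real"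
    by (rule sum.reindex_bij_witness[where i = "\<lambda>p. p \<circ> Transposition.transpose c d"
          and j = "\<lambda>p. p \<circ> Transposition.transpose c d"])
       (use closed that in \<open>auto simp: comp_assoc\<close>)
  have le: "(\<Sum>p\<in>G. \<Prod>x\<in>insert c S. a (p x)) \<le> (\<Sum>p\<in>G. a (p d) * (\<Prod>x\<in>S. a (p x)))"
    if d: "d \<in> B" for d
  proof (cases "d \<in> S")
    case False
    have "(\<Prod>x\<in>S. a ((p \<circ> Transposition.transpose c d) x)) = (\<Prod>x\<in>S. a (p x))" for p
    proof (rule prod.cong)
      fix x assume "x \<in> S"
      then have "x \<noteq> c" "x \<noteq> d" using False assms(2) by auto
      then show "a ((p \<circ> Transposition.transpose c d) x) = a (p x)"
        by (simp add: transpose_apply_other)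
    qed simp
    then have "(\<Sum>p\<in>G. a (p d) * (\<Prod>x\<in>S. a (p x))) = (\<Sum>p\<in>G. a (p c) * (\<Prod>x\<in>S. a (p x)))"
      by (subst reindex[OF d]) (simp del: comp_apply add: comp_apply[of _ _ d])
    then show ?thesis using assms by simp
  next
    \<comment> \<open>Here \<open>a (p d)\<close> occurs squared. By the swap its square has the
      same weighted sum as the square of \<open>a (p c)\<close>, so the mean of the two squares
      bounds the mixed product.\<close>
    case True
    define S' where "S' = S - {d}"
    have S: "S = insert d S'" "d \<notin> S'" "finite S'" "c \<notin> S'" "c \<noteq> d"
      using True assms unfolding S'_def by auto
    define R where "R p = (\<Prod>x\<in>S'. a (p x))" for p
    have R0: "R p \<ge> 0" for p unfolding R_def by (simp add: prod_nonneg nonneg)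
    have R: "R (p \<circ> Transposition.transpose c d) = R p" for p
      unfolding R_def
    proof (rule prod.cong)
      fix x assume "x \<in> S'"
      then have "x \<noteq> c" "x \<noteq> d" using S by auto
      then show "a ((p \<circ> Transposition.transpose c d) x) = a (p x)"
        by (simp add: transpose_apply_other)
    qed simp
    have "(\<Sum>p\<in>G. (a (p d))\<^sup>2 * R p) = (\<Sum>p\<in>G. (a (p c))\<^sup>2 * R p)"
      by (subst reindex[OF d]) (simp add: R)
    then have "(\<Sum>p\<in>G. (a (p d))\<^sup>2 * R p) = (\<Sum>p\<in>G. ((a (p c))\<^sup>2 + (a (p d))\<^sup>2) / 2 * R p)"
      by (simp add: sum.distrib add_divide_distrib distrib_right flip: sum_divide_distrib)
    also have "\<dots> \<ge> (\<Sum>p\<in>G. a (p c) * a (p d) * R p)"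
    proof (intro sum_mono mult_right_mono R0)
      fix p show "a (p c) * a (p d) \<le> ((a (p c))\<^sup>2 + (a (p d))\<^sup>2) / 2"
        using sum_squares_bound[of "a (p c)" "a (p d)"] by simp
    qed
    finally show ?thesis using S assms(1,2) by (simp add: R_def power2_eq_square mult.assoc)
  qed
  have "real (card B) * (\<Sum>p\<in>G. \<Prod>x\<in>insert c S. a (p x))
      \<le> (\<Sum>d\<in>B. \<Sum>p\<in>G. a (p d) * (\<Prod>x\<in>S. a (p x)))"
    using sum_mono[of B "\<lambda>_. (\<Sum>p\<in>G. \<Prod>x\<in>insert c S. a (p x))", OF le] by simp
  also have "\<dots> = (\<Sum>p\<in>G. (\<Sum>d\<in>B. a (p d)) * (\<Prod>x\<in>S. a (p x)))"
    by (subst sum.swap) (simp add: sum_distrib_right)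
  also have "\<dots> = T * (\<Sum>p\<in>G. \<Prod>x\<in>S. a (p x))"
    by (simp add: total sum_distrib_left)
  finally show ?thesis .
qed

text \<open>Induction on \<open>S\<close>, peeling off one factor at a time. The block
  \<open>B c\<close> may depend on \<open>c\<close>: the row of \<open>c\<close> for permutations
  within rows, the whole grid for all permutations. The right-hand side is what independent uniform
  draws from the blocks would give.\<close>

lemma sum_prod_le_block_averages:
  fixes a :: "'b \<Rightarrow> real" and G :: "('c \<Rightarrow> 'b) set"
  assumes "finite S"
    and nonneg: "\<And>x. 0 \<le> a x"
    and B: "\<And>c. c \<in> S \<Longrightarrow> finite (B c) \<and> c \<in> B c"
    and closed: "\<And>c d p. c \<in> S \<Longrightarrow> d \<in> B c \<Longrightarrow> p \<in> G \<Longrightarrow> p \<circ> Transposition.transpose c d \<in> G"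
    and total: "\<And>c p. c \<in> S \<Longrightarrow> p \<in> G \<Longrightarrow> (\<Sum>d\<in>B c. a (p d)) = T c"
  shows "(\<Sum>p\<in>G. \<Prod>x\<in>S. a (p x)) \<le> real (card G) * (\<Prod>x\<in>S. T x / real (card (B x)))"
  using assms(1,3-5)
proof (induction S)
  case empty
  then show ?case by simp
next
  case (insert c S)
  have pos: "real (card (B c)) > 0"
    using insert.prems(1)[of c] by (auto simp: card_gt_0_iff)
  show ?case
  proof (cases "G = {}")
    case False
    then obtain p where "p \<in> G" by auto
    then have T0: "T c \<ge> 0"
      using insert.prems(3)[of c p] by (simp flip: insert.prems(3) add: sum_nonneg nonneg)
    have "real (card (B c)) * (\<Sum>p\<in>G. \<Prod>x\<in>insert c S. a (p x)) \<le> T c * (\<Sum>p\<in>G. \<Prod>x\<in>S. a (p x))"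
    proof (rule sum_prod_insert_le)
      show "p \<circ> Transposition.transpose c d \<in> G" if "d \<in> B c" "p \<in> G" for d p
        using insert.prems(2) that by blast
    qed (use insert nonneg in auto)
    also have "\<dots> \<le> T c * (real (card G) * (\<Prod>x\<in>S. T x / real (card (B x))))"
      by (intro mult_left_mono T0 insert.IH) (use insert.prems in auto)
    finally show ?thesis using pos insert.hyps by (simp add: field_simps)
  qed simp
qed

text \<open>Discarding a smallest element never lowers the average; this is repeated until
  \<open>m\<close> elements remain. It serves to bound an average over all rows by one over
  \<open>m\<close> rows.\<close>

lemma exists_subset_above_average:
  fixes f :: "'b \<Rightarrow> real"
  assumes "finite A" "m \<le> card A"
  shows "\<exists>I\<subseteq>A. card I = m \<and> real m * sum f A \<le> real (card A) * sum f I"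
  using assms
proof (induction "card A - m" arbitrary: A)
  case 0
  then show ?case by (intro exI[of _ A]) auto
next
  case (Suc k)
  then have A: "A \<noteq> {}" by auto
  obtain x where x: "x \<in> A" "\<And>y. y \<in> A \<Longrightarrow> f x \<le> f y"
    using arg_min_if_finite(1)[OF Suc.prems(1) A] arg_min_least[OF Suc.prems(1) A] by blast
  define A' where "A' = A - {x}"
  have A': "finite A'" "card A' = card A - 1" "sum f A = f x + sum f A'"
    using x Suc.prems by (auto simp: A'_def sum.remove[of A x])
  obtain I where I: "I \<subseteq> A'" "card I = m" "real m * sum f A' \<le> real (card A') * sum f I"
    using Suc.hyps(1)[of A'] Suc.hyps(2) A' by fastforce
  have c: "real (card A) = real (card A') + 1" using A' Suc.hyps(2) by simp
  have fx: "real (card A') * f x \<le> sum f A'"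
    using sum_mono[of A' "\<lambda>_. f x" f] x by (auto simp: A'_def)
  have "real m * sum f A \<le> real (card A) * sum f I"
  proof (cases "card A' = 0")
    case True
    then have "m = 0" "I = {}" using Suc.hyps(2) A' I by auto
    then show ?thesis by simp
  next
    case False
    have "real (card A') * (real m * sum f A) = real m * (real (card A') * f x + real (card A') * sum f A')"
      by (simp add: A' algebra_simps)
    also have "\<dots> \<le> real m * (sum f A' + real (card A') * sum f A')"
      by (intro mult_left_mono add_mono fx) auto
    also have "\<dots> = real (card A) * (real m * sum f A')" by (simp add: c algebra_simps)
    also have "\<dots> \<le> real (card A) * (real (card A') * sum f I)" by (intro mult_left_mono I) auto
    finally have "real (card A') * (real m * sum f A) \<le> real (card A') * (real (card A) * sum f I)"
      by (simp add: mult.left_commute)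
    then show ?thesis using False by simp
  qed
  then show ?case using I by (intro exI[of _ I]) (auto simp: A'_def)
qed

section \<open>The two permutation groups and their closure under swaps\<close>

lemma finite_grid: "finite (grid M N)"
  by (simp add: grid_def)

lemma finite_all_perms: "finite (all_perms M N)"
  unfolding all_perms_def by (rule finite_permutations[OF finite_grid])

lemma finite_row_perms: "finite (row_perms M N)"
  unfolding row_perms_def using finite_all_perms by simp

lemma id_in_row_perms: "id \<in> row_perms M N"
  by (auto simp: row_perms_def all_perms_def permutes_id)

lemma all_perms_comp_transpose:
  assumes "p \<in> all_perms M N" "c \<in> grid M N" "d \<in> grid M N"
  shows "p \<circ> Transposition.transpose c d \<in> all_perms M N"
  using assms(1) permutes_compose[OF permutes_swap_id[OF assms(2,3)], of p]
  by (simp add: all_perms_def)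

lemma row_perms_comp_transpose:
  assumes "p \<in> row_perms M N" "i \<in> {1..M}" "j \<in> {1..N}" "j' \<in> {1..N}"
  shows "p \<circ> Transposition.transpose (i, j) (i, j') \<in> row_perms M N"
proof -
  let ?t = "Transposition.transpose (i, j) (i, j')"
  have "?t permutes {i} \<times> {1..N}" using assms by (intro permutes_swap_id) auto
  then have same: "?t ` ({i} \<times> {1..N}) = {i} \<times> {1..N}" by (rule permutes_image)
  have other: "?t ` ({l} \<times> {1..N}) = {l} \<times> {1..N}" if "l \<noteq> i" for l
  proof -
    have "?t ` ({l} \<times> {1..N}) = id ` ({l} \<times> {1..N})"
      by (rule image_cong) (use that in \<open>auto simp: transpose_apply_other\<close>)
    then show ?thesis by simp
  qed
  have "(p \<circ> ?t) ` ({l} \<times> {1..N}) = {l} \<times> {1..N}" if "l \<in> {1..M}" for l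
  proof -
    have "?t ` ({l} \<times> {1..N}) = {l} \<times> {1..N}" using same other by (cases "l = i") auto
    then have "(p \<circ> ?t) ` ({l} \<times> {1..N}) = p ` ({l} \<times> {1..N})" by (simp only: image_comp[symmetric])
    also have "\<dots> = {l} \<times> {1..N}" using assms(1) that by (simp add: row_perms_def)
    finally show ?thesis .
  qed
  moreover have "p \<circ> ?t \<in> all_perms M N"
    using assms by (intro all_perms_comp_transpose) (auto simp: row_perms_def grid_def)
  ultimately show ?thesis unfolding row_perms_def by blast
qed

text \<open>Comparison with independent draws for \<open>a = exp (t * x)\<close>, followed by
  \<open>y \<le> exp (y - 1)\<close> for each block average. Within rows the averages are
  \<open>r i / N\<close>, and \<open>B\<close> applies to \<open>I\<close> itself. For all
  permutations the average is the same at each cell, and \<open>B\<close> applies to some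
  \<open>m\<close> rows that have at least the mean row total.\<close>

lemma sum_exp_permuted_block_le:
  fixes x :: "nat \<times> nat \<Rightarrow> real"
  assumes G: "G = row_perms \<or> G = all_perms"
    and pos: "0 < m" "m \<le> M" "0 < n" "n \<le> N"
    and I: "I \<subseteq> {1..M}" "card I = m" and J: "J \<subseteq> {1..N}" "card J = n"
    and B: "\<And>I. I \<subseteq> {1..M} \<Longrightarrow> card I = m \<Longrightarrow> (\<Sum>i\<in>I. \<Sum>j\<in>{1..N}. exp (t * x (i, j)) - 1) \<le> B"
  shows "(\<Sum>p\<in>G M N. exp (t * (\<Sum>i\<in>I. \<Sum>j\<in>J. x (p (i, j)))))
     \<le> real (card (G M N)) * exp (real n / real N * B)"
proof -
  define a where "a c = exp (t * x c)" for c
  have a0: "a c \<ge> 0" for c by (simp add: a_def)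
  have fin: "finite I" "finite J" using I J finite_subset by blast+
  have exp_eq: "exp (t * (\<Sum>i\<in>I. \<Sum>j\<in>J. x (p (i, j)))) = (\<Prod>c\<in>I\<times>J. a (p c))" for p
    by (simp add: a_def sum.cartesian_product sum_distrib_left exp_sum fin case_prod_unfold)
  define r where "r i = (\<Sum>j\<in>{1..N}. a (i, j))" for i
  have r0: "r i \<ge> 0" for i by (simp add: r_def sum_nonneg a0)
  have rsum: "(\<Sum>i\<in>I'. r i - real N) \<le> B" if "I' \<subseteq> {1..M}" "card I' = m" for I'
    using B[OF that] by (simp add: r_def a_def sum_subtractf)
  have "N > 0" "M > 0" using pos by auto
  have le_exp: "y \<le> exp (y - 1)" for y :: real
    using exp_ge_add_one_self[of "y - 1"] by simp
  consider "G = row_perms" | "G = all_perms" using G by auto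
  then show ?thesis
  proof cases
    case 1
    have "(\<Sum>p\<in>G M N. \<Prod>c\<in>I\<times>J. a (p c)) \<le> real (card (G M N)) *
        (\<Prod>c\<in>I\<times>J. r (fst c) / real (card ({fst c} \<times> {1..N})))"
    proof (rule sum_prod_le_block_averages)
      fix c p assume c: "c \<in> I \<times> J" and p: "p \<in> G M N"
      have "fst c \<in> {1..M}" using c I by auto
      moreover have p': "p permutes grid M N" "\<forall>i\<in>{1..M}. p ` ({i} \<times> {1..N}) = {i} \<times> {1..N}"
        using p unfolding 1 row_perms_def all_perms_def mem_Collect_eq by blast+
      ultimately have "p ` ({fst c} \<times> {1..N}) = {fst c} \<times> {1..N}" by blast
      then have "bij_betw p ({fst c} \<times> {1..N}) ({fst c} \<times> {1..N})"
        using permutes_inj_on[OF p'(1)] unfolding bij_betw_def by blast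
      then have "(\<Sum>d\<in>{fst c} \<times> {1..N}. a (p d)) = (\<Sum>d\<in>{fst c} \<times> {1..N}. a d)"
        by (rule sum.reindex_bij_betw)
      also have "\<dots> = r (fst c)" 
        using sum.cartesian_product[of "\<lambda>i j. a (i, j)" "{1..N}" "{fst c}"] by (simp add: r_def)
      finally show "(\<Sum>d\<in>{fst c} \<times> {1..N}. a (p d)) = r (fst c)" .
    next
      fix c d p assume c: "c \<in> I \<times> J" and d: "d \<in> {fst c} \<times> {1..N}" and p: "p \<in> G M N"
      obtain i j j' where cd: "c = (i, j)" "d = (i, j')" using d by (cases c) auto
      have "i \<in> {1..M}" "j \<in> {1..N}" "j' \<in> {1..N}" using c d cd I J by auto
      then show "p \<circ> Transposition.transpose c d \<in> G M N"
        using p row_perms_comp_transpose unfolding cd 1 by blast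
    qed (use fin a0 I J in auto)
    also have "(\<Prod>c\<in>I\<times>J. r (fst c) / real (card ({fst c} \<times> {1..N})))
        \<le> (\<Prod>c\<in>I\<times>J. exp (r (fst c) / real N - 1))"
      using r0 le_exp by (intro prod_mono) auto
    also have "\<dots> = exp (\<Sum>c\<in>I\<times>J. r (fst c) / real N - 1)"
      by (simp add: exp_sum fin)
    also have "(\<Sum>c\<in>I\<times>J. r (fst c) / real N - 1) = (\<Sum>i\<in>I. \<Sum>j\<in>J. r i / real N - 1)"
      unfolding sum.cartesian_product case_prod_unfold ..
    also have "\<dots> = real n / real N * (\<Sum>i\<in>I. r i - real N)"
      using \<open>N > 0\<close> J by (simp add: sum_distrib_left field_simps)
    also have "exp \<dots> \<le> exp (real n / real N * B)"
      unfolding exp_le_cancel_iff by (rule mult_left_mono[OF rsum[OF I]]) simp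
    finally show ?thesis by (simp add: exp_eq mult_left_mono)
  next
    case 2
    define T where "T = (\<Sum>i\<in>{1..M}. r i)"
    have "(\<Sum>p\<in>G M N. \<Prod>c\<in>I\<times>J. a (p c)) \<le> real (card (G M N)) *
        (\<Prod>c\<in>I\<times>J. T / real (card (grid M N)))"
    proof (rule sum_prod_le_block_averages)
      fix c p assume c: "c \<in> I \<times> J" and p: "p \<in> G M N"
      have "p permutes grid M N" using p 2 unfolding all_perms_def by auto
      then have "(\<Sum>d\<in>grid M N. a (p d)) = (\<Sum>d\<in>grid M N. a d)"
        by (intro sum.reindex_bij_betw permutes_imp_bij)
      also have "\<dots> = T" by (simp add: r_def T_def grid_def sum.cartesian_product case_prod_unfold)
      finally show "(\<Sum>d\<in>grid M N. a (p d)) = T" .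
    next
      fix c d p assume "c \<in> I \<times> J" "d \<in> grid M N" "p \<in> G M N"
      then show "p \<circ> Transposition.transpose c d \<in> G M N"
        using 2 I J all_perms_comp_transpose[of p M N c d] by (auto simp: grid_def)
    qed (use fin a0 I J finite_grid in \<open>auto simp: grid_def\<close>)
    also have "(\<Prod>c\<in>I\<times>J. T / real (card (grid M N))) = (T / (real M * real N)) ^ (m * n)"
      using I J by (simp add: grid_def card_cartesian_product)
    also have "\<dots> \<le> exp (T / (real M * real N) - 1) ^ (m * n)"
      using r0 by (intro power_mono le_exp) (auto simp: T_def sum_nonneg)
    also have "\<dots> = exp (real (m * n) * (T / (real M * real N) - 1))"
      by (simp only: exp_of_nat_mult)
    also have "\<dots> \<le> exp (real n / real N * B)"
    proof -
      obtain I' where I': "I' \<subseteq> {1..M}" "card I' = m"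
        "real m * (\<Sum>i\<in>{1..M}. r i - real N) \<le> real (card {1..M}) * (\<Sum>i\<in>I'. r i - real N)"
        using exists_subset_above_average[of "{1..M}" m "\<lambda>i. r i - real N"] pos by auto
      have "real m * (\<Sum>i\<in>{1..M}. r i - real N) \<le> real M * B"
        using I'(3) mult_left_mono[OF rsum[OF I'(1,2)], of "real M"] by simp
      then have *: "real m * (T - real M * real N) \<le> real M * B"
        by (simp add: T_def sum_subtractf)
      have "real (m * n) * (T / (real M * real N) - 1)
          = real n / (real M * real N) * (real m * (T - real M * real N))"
        using \<open>M > 0\<close> \<open>N > 0\<close> by (simp add: field_simps)
      also have "\<dots> \<le> real n / (real M * real N) * (real M * B)"
        by (intro mult_left_mono *) auto
      also have "\<dots> = real n / real N * B" using \<open>M > 0\<close> by simp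
      finally show ?thesis by simp
    qed
    finally show ?thesis by (simp add: exp_eq mult_left_mono)
  qed
qed

section \<open>The P-value bounded by a union over blocks\<close>

lemma subsets_of_card_nonempty:
  assumes "m \<le> card A" "finite A" shows "{I. I \<subseteq> A \<and> card I = m} \<noteq> {}"
  using obtain_subset_with_card_n[OF assms(1)] by blast

lemma scan_ge:
  assumes "I \<subseteq> {1..M}" "card I = m" "J \<subseteq> {1..N}" "card J = n"
  shows "(\<Sum>i\<in>I. \<Sum>j\<in>J. x (i, j)) \<le> scan M N m n x"
proof -
  have "(\<Sum>i\<in>I. \<Sum>j\<in>J. x (i, j)) \<le> (MAX J \<in> {J. J \<subseteq> {1..N} \<and> card J = n}. \<Sum>i\<in>I. \<Sum>j\<in>J. x (i, j))"
    using assms by (intro Max_ge) auto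
  also have "\<dots> \<le> scan M N m n x"
    unfolding scan_def using assms by (intro Max_ge) auto
  finally show ?thesis .
qed

lemma scan_attained:
  assumes "m \<le> M" "n \<le> N"
  obtains I J where "I \<subseteq> {1..M}" "card I = m" "J \<subseteq> {1..N}" "card J = n"
    "scan M N m n x = (\<Sum>i\<in>I. \<Sum>j\<in>J. x (i, j))"
proof -
  have ne: "{I. I \<subseteq> {1..M} \<and> card I = m} \<noteq> {}" "{J. J \<subseteq> {1..N} \<and> card J = n} \<noteq> {}"
    using assms subsets_of_card_nonempty[of m "{1..M}"] subsets_of_card_nonempty[of n "{1..N}"] by simp_all
  have "scan M N m n x \<in> (\<lambda>I. MAX J \<in> {J. J \<subseteq> {1..N} \<and> card J = n}. \<Sum>i\<in>I. \<Sum>j\<in>J. x (i, j))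
      ` {I. I \<subseteq> {1..M} \<and> card I = m}"
    unfolding scan_def using ne by (intro Max_in) auto
  then obtain I where I: "I \<subseteq> {1..M}" "card I = m"
    "scan M N m n x = (MAX J \<in> {J. J \<subseteq> {1..N} \<and> card J = n}. \<Sum>i\<in>I. \<Sum>j\<in>J. x (i, j))" by auto
  have "scan M N m n x \<in> (\<lambda>J. \<Sum>i\<in>I. \<Sum>j\<in>J. x (i, j)) ` {J. J \<subseteq> {1..N} \<and> card J = n}"
    unfolding I(3) using ne by (intro Max_in) auto
  with I that show ?thesis by auto
qed

text \<open>Markov's inequality by counting. The observed scan is at least the sum \<open>s\<close>
  over \<open>I0 \<times> J0\<close>, so each permutation counted in the P-value has a block whose
  permuted sum reaches \<open>s\<close>; hence \<open>1\<close> is at most the sum over all blocks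
  of \<open>exp\<close> of \<open>t\<close> times the excess over \<open>s\<close>. Averaging over
  the group bounds each block term, and the binomials count the blocks.\<close>

lemma perm_pvalue_le:
  fixes x :: "nat \<times> nat \<Rightarrow> real"
  assumes G: "G = row_perms \<or> G = all_perms"
    and pos: "0 < m" "m \<le> M" "0 < n" "n \<le> N" "0 \<le> t"
    and I0: "I0 \<subseteq> {1..M}" "card I0 = m" and J0: "J0 \<subseteq> {1..N}" "card J0 = n"
    and B: "\<And>I. I \<subseteq> {1..M} \<Longrightarrow> card I = m \<Longrightarrow> (\<Sum>i\<in>I. \<Sum>j\<in>{1..N}. exp (t * x (i, j)) - 1) \<le> B"
  shows "perm_pvalue (G M N) M N m n x \<le> real (M choose m) * real (N choose n) *
     exp (real n / real N * B - t * (\<Sum>i\<in>I0. \<Sum>j\<in>J0. x (i, j)))"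
proof -
  define s where "s = (\<Sum>i\<in>I0. \<Sum>j\<in>J0. x (i, j))"
  define U where "U = {I. I \<subseteq> {1..M} \<and> card I = m} \<times> {J. J \<subseteq> {1..N} \<and> card J = n}"
  have finU: "finite U" by (simp add: U_def)
  have finG: "finite (G M N)" using G finite_all_perms finite_row_perms by auto
  have "id \<in> G M N" using G id_in_row_perms[of M N] by (auto simp: row_perms_def)
  then have cG: "real (card (G M N)) > 0" using finG by (auto simp: card_gt_0_iff)
  define w where "w p I J = exp (t * (\<Sum>i\<in>I. \<Sum>j\<in>J. x (p (i, j))))" for p and I J :: "nat set"
  have "real (card {p \<in> G M N. scan M N m n (\<lambda>ij. x (p ij)) \<ge> scan M N m n x})
      = (\<Sum>p\<in>{p \<in> G M N. scan M N m n (\<lambda>ij. x (p ij)) \<ge> scan M N m n x}. 1)" by simp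
  also have "\<dots> \<le> (\<Sum>p\<in>{p \<in> G M N. scan M N m n (\<lambda>ij. x (p ij)) \<ge> scan M N m n x}.
      \<Sum>(I, J)\<in>U. exp (- t * s) * w p I J)"
  proof (rule sum_mono)
    fix p assume p: "p \<in> {p \<in> G M N. scan M N m n (\<lambda>ij. x (p ij)) \<ge> scan M N m n x}"
    obtain I J where IJ: "I \<subseteq> {1..M}" "card I = m" "J \<subseteq> {1..N}" "card J = n"
      "scan M N m n (\<lambda>ij. x (p ij)) = (\<Sum>i\<in>I. \<Sum>j\<in>J. x (p (i, j)))"
      using scan_attained[OF pos(2,4), of "\<lambda>ij. x (p ij)"] by blast
    have "s \<le> scan M N m n x" unfolding s_def by (rule scan_ge[OF I0 J0])
    then have "s \<le> (\<Sum>i\<in>I. \<Sum>j\<in>J. x (p (i, j)))" using p IJ by simp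
    then have "0 \<le> - t * s + t * (\<Sum>i\<in>I. \<Sum>j\<in>J. x (p (i, j)))"
      using pos(5) by (simp add: mult_left_mono)
    then have "1 \<le> exp (- t * s) * w p I J" unfolding w_def
      by (simp only: exp_add[symmetric] one_le_exp_iff)
    also have "\<dots> = (\<lambda>(I, J). exp (- t * s) * w p I J) (I, J)" by simp
    also have "\<dots> \<le> (\<Sum>(I, J)\<in>U. exp (- t * s) * w p I J)"
      by (rule member_le_sum) (use IJ finU in \<open>auto simp: U_def w_def\<close>)
    finally show "1 \<le> (\<Sum>(I, J)\<in>U. exp (- t * s) * w p I J)" .
  qed
  also have "\<dots> \<le> (\<Sum>p\<in>G M N. \<Sum>(I, J)\<in>U. exp (- t * s) * w p I J)"
    by (rule sum_mono2) (use finG in \<open>auto intro!: sum_nonneg simp: w_def\<close>)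
  also have "\<dots> = (\<Sum>(I, J)\<in>U. exp (- t * s) * (\<Sum>p\<in>G M N. w p I J))"
    by (subst sum.swap) (simp add: case_prod_unfold sum_distrib_left)
  also have "\<dots> \<le> (\<Sum>(I, J)\<in>U. exp (- t * s) * (real (card (G M N)) * exp (real n / real N * B)))"
    unfolding w_def
    by (intro sum_mono, clarify, intro mult_left_mono sum_exp_permuted_block_le)
       (use G pos B in \<open>auto simp: U_def\<close>)
  also have "\<dots> = real (card (G M N)) * (real (M choose m) * real (N choose n) * exp (real n / real N * B - t * s))"
    by (simp add: U_def card_cartesian_product n_subsets exp_diff exp_minus field_simps)
  finally show ?thesis using cG by (simp add: perm_pvalue_def s_def field_simps)
qed

lemma borel_measurable_scan:
  assumes "\<And>c. c \<in> grid M N \<Longrightarrow> X c \<in> borel_measurable P"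
  shows "(\<lambda>\<omega>. scan M N m n (\<lambda>c. X c \<omega>)) \<in> borel_measurable P"
  unfolding scan_def
  by (intro borel_measurable_Max borel_measurable_sum assms) (auto simp: grid_def)

lemma perms_subset_all_perms: "G = row_perms \<or> G = all_perms \<Longrightarrow> G M N \<subseteq> all_perms M N"
  by (auto simp: row_perms_def)

text \<open>A finite sum of indicators of comparisons between scans. Group elements keep indices
  inside the grid, where the entries are known to be measurable.\<close>

lemma borel_measurable_perm_pvalue:
  assumes "\<And>c. c \<in> grid M N \<Longrightarrow> X c \<in> borel_measurable P" and G: "G \<subseteq> all_perms M N"
  shows "(\<lambda>\<omega>. perm_pvalue G M N m n (\<lambda>c. X c \<omega>)) \<in> borel_measurable P"
proof -
  have fin: "finite G" using G finite_all_perms finite_subset by blast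
  define s where "s p \<omega> = scan M N m n (\<lambda>c. X (p c) \<omega>)" for p \<omega>
  have s: "s p \<in> borel_measurable P" if "p \<in> G" for p
    unfolding s_def
  proof (rule borel_measurable_scan)
    fix c assume "c \<in> grid M N"
    moreover have "p permutes grid M N" using that G by (auto simp: all_perms_def)
    ultimately show "X (p c) \<in> borel_measurable P" by (intro assms(1)) (simp add: permutes_in_image)
  qed
  have s0: "s id \<in> borel_measurable P"
    unfolding s_def using borel_measurable_scan[of M N X P] assms(1) by simp
  have "perm_pvalue G M N m n (\<lambda>c. X c \<omega>) = (\<Sum>p\<in>G. if s id \<omega> \<le> s p \<omega> then 1 else 0) / real (card G)" for \<omega>
    using fin by (simp add: perm_pvalue_def s_def sum.If_cases Int_def)
  moreover have "(\<lambda>\<omega>. (\<Sum>p\<in>G. if s id \<omega> \<le> s p \<omega> then 1 else 0) / real (card G)) \<in> borel_measurable P"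
    using s s0 by (intro borel_measurable_divide borel_measurable_sum borel_measurable_const
      measurable_If borel_measurable_pred_less pred_le_const) auto
  ultimately show ?thesis by simp
qed

section \<open>Exponential inequalities and second moments\<close>

lemma exp_minus_one_le: "\<bar>exp x - 1\<bar> \<le> \<bar>x\<bar> * exp (max x 0)" for x :: real
proof (cases "x \<ge> 0")
  case True
  have "1 - x \<le> exp (- x)" using exp_ge_add_one_self[of "- x"] by simp
  then have "(1 - x) * exp x \<le> exp (- x) * exp x" by (rule mult_right_mono) simp
  then show ?thesis using True by (simp add: algebra_simps exp_minus_inverse)
next
  case False
  then have "\<bar>exp x - 1\<bar> = 1 - exp x" "\<bar>x\<bar> * exp (max x 0) = - x" by auto
  then show ?thesis using exp_ge_add_one_self[of x] by linarith
qed

text \<open>Taylor's formula for \<open>x \<ge> 0\<close>. For \<open>x < 0\<close> the factor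
  \<open>exp (max x 0)\<close> is \<open>1\<close>, and \<open>1 + x + x\<^sup>2 / 2 - exp x\<close>
  decreases towards its value \<open>0\<close> at the origin.\<close>

lemma exp_le_quadratic: "exp x \<le> 1 + x + x\<^sup>2 / 2 * exp (max x 0)" for x :: real
proof (cases "x \<ge> 0")
  case True
  obtain u where u: "\<bar>u\<bar> \<le> \<bar>x\<bar>" "exp x = (\<Sum>m<2. x ^ m / fact m) + exp u / fact 2 * x ^ 2"
    using Maclaurin_exp_le[of x 2] by blast
  have "exp u \<le> exp x" using u(1) True by simp
  then have "exp u / 2 * x\<^sup>2 \<le> exp x / 2 * x\<^sup>2" by (intro mult_right_mono) auto
  then show ?thesis using u(2) True by (simp add: numeral_2_eq_2 mult.commute)
next
  case False
  define f where "f x = 1 + x + x\<^sup>2 / 2 - exp x" for x :: real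
  have "f 0 \<le> f x"
  proof (rule DERIV_nonpos_imp_nonincreasing[of x 0 f])
    fix y :: real
    have "(f has_real_derivative 1 + y - exp y) (at y)"
      unfolding f_def by (auto intro!: derivative_eq_intros)
    moreover have "1 + y - exp y \<le> 0" using exp_ge_add_one_self[of y] by linarith
    ultimately show "\<exists>D. (f has_real_derivative D) (at y) \<and> D \<le> 0" by blast
  qed (use False in auto)
  then show ?thesis using False by (simp add: f_def)
qed

text \<open>One weight that dominates everything integrated below: the square, the quadratic
  remainder of the exponential and, after doubling the exponent, the square of
  \<open>exp (t * x) - 1\<close>. It is exponential on the positive side only.\<close>

definition tilted_square :: "real \<Rightarrow> real \<Rightarrow> real" where
  "tilted_square d x = x\<^sup>2 * exp (d * max x 0)"

lemma tilted_square_nonneg: "0 \<le> tilted_square d x"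
  by (simp add: tilted_square_def)

lemma borel_measurable_tilted_square [measurable]: "tilted_square d \<in> borel_measurable borel"
  unfolding tilted_square_def by measurable

lemma tilted_square_mono: "d \<le> d' \<Longrightarrow> tilted_square d x \<le> tilted_square d' x"
  unfolding tilted_square_def by (intro mult_left_mono) (auto intro: mult_right_mono)

lemma square_le_tilted_square: "0 \<le> d \<Longrightarrow> x\<^sup>2 \<le> tilted_square d x"
  using tilted_square_mono[of 0 d x] by (simp add: tilted_square_def)

lemma max_mult_zero: "0 \<le> t \<Longrightarrow> max (t * x) 0 = t * max x 0" for t x :: real
  by (simp add: max_mult_distrib_left)

text \<open>Squaring doubles the exponent, whence the requirement
  \<open>2 * t \<le> d\<close>.\<close>

lemma exp_minus_one_square_le:
  assumes "0 \<le> t" "2 * t \<le> d"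
  shows "(exp (t * x) - 1)\<^sup>2 \<le> t\<^sup>2 * tilted_square d x"
proof -
  have "\<bar>exp (t * x) - 1\<bar>\<^sup>2 \<le> (\<bar>t * x\<bar> * exp (max (t * x) 0))\<^sup>2"
    by (intro power_mono exp_minus_one_le) auto
  also have "\<dots> = t\<^sup>2 * tilted_square (2 * t) x"
    by (simp add: max_mult_zero assms tilted_square_def power_mult_distrib flip: exp_double)
  also have "\<dots> \<le> t\<^sup>2 * tilted_square d x" by (intro mult_left_mono tilted_square_mono assms) auto
  finally show ?thesis by simp
qed

lemma exp_le_tilted_square:
  assumes "0 \<le> t" "t \<le> d"
  shows "exp (t * x) \<le> 1 + t * x + t\<^sup>2 / 2 * tilted_square d x"
proof -
  have "exp (t * x) \<le> 1 + t * x + (t * x)\<^sup>2 / 2 * exp (max (t * x) 0)" by (rule exp_le_quadratic)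
  also have "\<dots> = 1 + t * x + t\<^sup>2 / 2 * tilted_square t x"
    by (simp add: max_mult_zero assms tilted_square_def power_mult_distrib)
  also have "\<dots> \<le> 1 + t * x + t\<^sup>2 / 2 * tilted_square d x"
    by (intro add_left_mono mult_left_mono tilted_square_mono assms) auto
  finally show ?thesis .
qed

lemma (in prob_space) expectation_square_sum_le:
  fixes Y :: "'i \<Rightarrow> 'a \<Rightarrow> real"
  assumes A: "finite A" and indep: "indep_vars (\<lambda>_. borel) Y A"
    and sq: "\<And>i. i \<in> A \<Longrightarrow> integrable M (\<lambda>x. (Y i x)\<^sup>2)"
    and mean: "\<And>i. i \<in> A \<Longrightarrow> expectation (Y i) = 0"
    and var: "\<And>i. i \<in> A \<Longrightarrow> expectation (\<lambda>x. (Y i x)\<^sup>2) \<le> C"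
  shows "integrable M (\<lambda>x. (\<Sum>i\<in>A. Y i x)\<^sup>2)"
    and "expectation (\<lambda>x. (\<Sum>i\<in>A. Y i x)\<^sup>2) \<le> C * real (card A)"
proof -
  have meas: "Y i \<in> borel_measurable M" if "i \<in> A" for i
    using indep that by (auto simp: indep_vars_def)
  have int: "integrable M (Y i)" if "i \<in> A" for i
    using square_integrable_imp_integrable[OF meas[OF that] sq[OF that]] .
  have cross: "integrable M (\<lambda>x. Y i x * Y j x) \<and> expectation (\<lambda>x. Y i x * Y j x) = (if i = j then expectation (\<lambda>x. (Y i x)\<^sup>2) else 0)"
    if "i \<in> A" "j \<in> A" for i j
  proof (cases "i = j")
    case True
    then show ?thesis using sq[OF that(1)] by (simp add: power2_eq_square)
  next
    case False
    have ind: "indep_vars (\<lambda>_. borel) Y {i, j}" using indep_vars_subset[OF indep] that by auto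
    show ?thesis
      using indep_vars_lebesgue_integral[OF _ ind] indep_vars_integrable[OF _ ind] False int that mean
      by auto
  qed
  have eq: "(\<Sum>i\<in>A. Y i x)\<^sup>2 = (\<Sum>i\<in>A. \<Sum>j\<in>A. Y i x * Y j x)" for x
    by (simp add: power2_eq_square sum_product)
  show "integrable M (\<lambda>x. (\<Sum>i\<in>A. Y i x)\<^sup>2)" unfolding eq using cross by auto
  have "expectation (\<lambda>x. (\<Sum>i\<in>A. Y i x)\<^sup>2) = (\<Sum>i\<in>A. \<Sum>j\<in>A. expectation (\<lambda>x. Y i x * Y j x))"
    unfolding eq using cross by (subst Bochner_Integration.integral_sum; simp)+
  also have "\<dots> = (\<Sum>i\<in>A. expectation (\<lambda>x. (Y i x)\<^sup>2))"
    using cross A by (simp cong: sum.cong add: sum.delta)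
  also have "\<dots> \<le> C * real (card A)" using sum_bounded_above[of A _ C] var by (simp add: mult.commute)
  finally show "expectation (\<lambda>x. (\<Sum>i\<in>A. Y i x)\<^sup>2) \<le> C * real (card A)" .
qed

lemma (in prob_space) prob_ge_le_expectation:
  assumes "integrable M u" "\<And>x. x \<in> space M \<Longrightarrow> 0 \<le> u x" "0 < (c::real)" "expectation u \<le> b"
  shows "prob {x\<in>space M. c \<le> u x} \<le> b / c"
proof -
  have "prob {x\<in>space M. c \<le> u x} \<le> expectation u / c"
    by (rule integral_Markov_inequality_measure[where A = "{}"]) (use assms in auto)
  also have "\<dots> \<le> b / c" using assms by (simp add: divide_right_mono)
  finally show ?thesis .
qed

section \<open>A single sample with an elevated submatrix\<close>

text \<open>One member of the sequence. The exponential parameter \<open>t\<close> varies with the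
  member, while \<open>d\<close> and \<open>C\<close> are meant to be fixed; one moment bound covers
  null and elevated entries. \<open>2 * t \<le> d\<close> yields second moments of
  \<open>exp (t * X) - 1\<close>.\<close>

locale submatrix_sample = prob_space P for P :: "'a measure" +
  fixes X :: "nat \<times> nat \<Rightarrow> 'a \<Rightarrow> real" and M N m n :: nat and I0 J0 :: "nat set" and t d C :: real
  assumes indep: "indep_vars (\<lambda>_. borel) X (grid M N)"
    and I0: "I0 \<subseteq> {1..M}" "card I0 = m" and J0: "J0 \<subseteq> {1..N}" "card J0 = n"
    and pos: "0 < m" "0 < n" and t: "0 < t" "t \<le> 1" "2 * t \<le> d"
    and moment: "\<And>c. c \<in> grid M N \<Longrightarrow> integrable P (\<lambda>\<omega>. tilted_square d (X c \<omega>))"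
      "\<And>c. c \<in> grid M N \<Longrightarrow> expectation (\<lambda>\<omega>. tilted_square d (X c \<omega>)) \<le> C"
begin

lemma measurable_X [measurable]: "c \<in> grid M N \<Longrightarrow> X c \<in> borel_measurable P"
  using indep by (auto simp: indep_vars_def)

lemma size_le: "m \<le> M" "n \<le> N"
  using I0 J0 card_mono[of "{1..M}" I0] card_mono[of "{1..N}" J0] by auto

lemma finite_anomalous: "finite I0" "finite J0"
  using I0 J0 finite_subset by blast+

lemma anomalous_subset_grid: "I0 \<times> J0 \<subseteq> grid M N"
  using I0 J0 by (auto simp: grid_def)

lemma C_nonneg: "0 \<le> C"
proof -
  obtain c where c: "c \<in> grid M N" using anomalous_subset_grid pos I0 J0 by (metis card.empty equals0I subsetD less_irrefl SigmaI)
  have "0 \<le> expectation (\<lambda>\<omega>. tilted_square d (X c \<omega>))"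
    by (simp add: tilted_square_nonneg integral_nonneg_AE)
  then show ?thesis using moment(2)[OF c] by simp
qed

lemma integrable_square: "c \<in> grid M N \<Longrightarrow> integrable P (\<lambda>\<omega>. (X c \<omega>)\<^sup>2)"
  and expectation_square: "c \<in> grid M N \<Longrightarrow> expectation (\<lambda>\<omega>. (X c \<omega>)\<^sup>2) \<le> C"
proof -
  assume c: "c \<in> grid M N"
  have le: "(X c \<omega>)\<^sup>2 \<le> tilted_square d (X c \<omega>)" for \<omega> using t by (intro square_le_tilted_square) auto
  show int: "integrable P (\<lambda>\<omega>. (X c \<omega>)\<^sup>2)"
    by (rule Bochner_Integration.integrable_bound[OF moment(1)[OF c]])
       (use c le in \<open>auto simp: tilted_square_nonneg\<close>)
  show "expectation (\<lambda>\<omega>. (X c \<omega>)\<^sup>2) \<le> C"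
    using integral_mono[OF int moment(1)[OF c] le] moment(2)[OF c] by linarith
qed

lemma integrable_X: "c \<in> grid M N \<Longrightarrow> integrable P (X c)"
  using square_integrable_imp_integrable[OF _ integrable_square] by auto

text \<open>Sums of these over \<open>m\<close> full rows are what \<open>perm_pvalue_le\<close>
  requires to be at most \<open>B\<close>.\<close>

definition V :: "nat \<times> nat \<Rightarrow> 'a \<Rightarrow> real" where
  "V c \<omega> = exp (t * X c \<omega>) - 1"

lemma measurable_V [measurable]: "c \<in> grid M N \<Longrightarrow> V c \<in> borel_measurable P"
  unfolding V_def by measurable

lemma integrable_V_square: "c \<in> grid M N \<Longrightarrow> integrable P (\<lambda>\<omega>. (V c \<omega>)\<^sup>2)"
  and expectation_V_square: "c \<in> grid M N \<Longrightarrow> expectation (\<lambda>\<omega>. (V c \<omega>)\<^sup>2) \<le> C * t\<^sup>2"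
proof -
  assume c: "c \<in> grid M N"
  have le: "(V c \<omega>)\<^sup>2 \<le> t\<^sup>2 * tilted_square d (X c \<omega>)" for \<omega>
    unfolding V_def using t by (intro exp_minus_one_square_le) auto
  have int': "integrable P (\<lambda>\<omega>. t\<^sup>2 * tilted_square d (X c \<omega>))" using moment(1)[OF c] by simp
  show int: "integrable P (\<lambda>\<omega>. (V c \<omega>)\<^sup>2)"
    by (rule Bochner_Integration.integrable_bound[OF int'])
       (use c le in \<open>auto simp: tilted_square_nonneg\<close>)
  have "expectation (\<lambda>\<omega>. (V c \<omega>)\<^sup>2) \<le> t\<^sup>2 * expectation (\<lambda>\<omega>. tilted_square d (X c \<omega>))"
    using integral_mono[OF int int' le] by simp
  also have "\<dots> \<le> t\<^sup>2 * C" by (intro mult_left_mono moment(2) c) auto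
  finally show "expectation (\<lambda>\<omega>. (V c \<omega>)\<^sup>2) \<le> C * t\<^sup>2" by (simp add: mult.commute)
qed

lemma integrable_V: "c \<in> grid M N \<Longrightarrow> integrable P (V c)"
  using square_integrable_imp_integrable[OF _ integrable_V_square] by auto

lemma expectation_V_ge:
  assumes "c \<in> grid M N" shows "t * expectation (X c) \<le> expectation (V c)"
proof -
  have "(\<integral>\<omega>. t * X c \<omega> \<partial>P) \<le> (\<integral>\<omega>. V c \<omega> \<partial>P)"
  proof (rule integral_mono)
    show "t * X c \<omega> \<le> V c \<omega>" for \<omega> unfolding V_def using exp_ge_add_one_self[of "t * X c \<omega>"] by linarith
  qed (use assms integrable_X integrable_V in auto)
  then show ?thesis by simp
qed

lemma expectation_V_le:
  assumes c: "c \<in> grid M N" shows "expectation (V c) \<le> t * expectation (X c) + C / 2 * t\<^sup>2"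
proof -
  have "(\<integral>\<omega>. V c \<omega> \<partial>P) \<le> (\<integral>\<omega>. t * X c \<omega> + t\<^sup>2 / 2 * tilted_square d (X c \<omega>) \<partial>P)"
  proof (rule integral_mono)
    show "V c \<omega> \<le> t * X c \<omega> + t\<^sup>2 / 2 * tilted_square d (X c \<omega>)" for \<omega>
      unfolding V_def using exp_le_tilted_square[of t d "X c \<omega>"] t by linarith
  qed (use c integrable_X integrable_V moment(1) in auto)
  also have "\<dots> = t * expectation (X c) + t\<^sup>2 / 2 * expectation (\<lambda>\<omega>. tilted_square d (X c \<omega>))"
    using c integrable_X moment(1) by simp
  also have "\<dots> \<le> t * expectation (X c) + t\<^sup>2 / 2 * C"
    by (intro add_left_mono mult_left_mono moment(2) c) auto
  finally show ?thesis by (simp add: field_simps)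
qed

text \<open>Stated for a function \<open>g\<close> of the entries so that it serves twice: with the
  identity for the observed signal and with \<open>exp (t * x) - 1\<close> for the row
  fluctuations.\<close>

lemma expectation_centered_sum_square:
  assumes A: "A \<subseteq> grid M N" and g [measurable]: "g \<in> borel_measurable borel"
    and int: "\<And>c. c \<in> A \<Longrightarrow> integrable P (\<lambda>\<omega>. (g (X c \<omega>))\<^sup>2)"
    and var: "\<And>c. c \<in> A \<Longrightarrow> expectation (\<lambda>\<omega>. (g (X c \<omega>))\<^sup>2) \<le> K"
  defines "Z \<equiv> \<lambda>\<omega>. \<Sum>c\<in>A. g (X c \<omega>) - expectation (\<lambda>\<omega>. g (X c \<omega>))"
  shows "integrable P (\<lambda>\<omega>. (Z \<omega>)\<^sup>2)" "expectation (\<lambda>\<omega>. (Z \<omega>)\<^sup>2) \<le> K * real (card A)"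
    "Z \<in> borel_measurable P"
proof -
  define Y where "Y c \<omega> = g (X c \<omega>) - expectation (\<lambda>\<omega>. g (X c \<omega>))" for c \<omega>
  have finA: "finite A" using A finite_grid finite_subset by blast
  have meas: "X c \<in> borel_measurable P" if "c \<in> A" for c using A that by auto
  have ind: "indep_vars (\<lambda>_. borel) Y A"
    unfolding Y_def by (rule indep_vars_compose2[OF indep_vars_subset[OF indep A]]) measurable
  have int1: "integrable P (\<lambda>\<omega>. g (X c \<omega>))" if "c \<in> A" for c
    using square_integrable_imp_integrable[OF _ int[OF that]] meas[OF that] by auto
  have sq: "integrable P (\<lambda>\<omega>. (Y c \<omega>)\<^sup>2)" if "c \<in> A" for c
    unfolding Y_def power2_diff using int[OF that] int1[OF that] by auto
  have mean: "expectation (Y c) = 0" if "c \<in> A" for c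
    unfolding Y_def using int1[OF that] by (simp add: prob_space)
  have v: "expectation (\<lambda>\<omega>. (Y c \<omega>)\<^sup>2) \<le> K" if "c \<in> A" for c
    unfolding Y_def using variance_eq[OF int1[OF that] int[OF that]] var[OF that]
      zero_le_power2[of "expectation (\<lambda>\<omega>. g (X c \<omega>))"] by linarith
  have Z: "Z = (\<lambda>\<omega>. \<Sum>c\<in>A. Y c \<omega>)" unfolding Z_def Y_def ..
  show "integrable P (\<lambda>\<omega>. (Z \<omega>)\<^sup>2)" "expectation (\<lambda>\<omega>. (Z \<omega>)\<^sup>2) \<le> K * real (card A)"
    unfolding Z using expectation_square_sum_le[OF finA ind sq mean v] by auto
  show "Z \<in> borel_measurable P" unfolding Z_def using meas by (intro borel_measurable_sum) auto
qed

text \<open>Chebyshev's inequality: the variances of the \<open>m * n\<close> independent entries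
  add up. It keeps the observed sum over the elevated block from falling far below its mean.\<close>

lemma prob_anomalous_sum_small:
  assumes "0 < y"
  shows "prob {\<omega> \<in> space P. (\<Sum>c\<in>I0\<times>J0. X c \<omega> - expectation (X c)) \<le> - y} \<le> C * real (m * n) / y\<^sup>2"
proof -
  define Z where "Z \<omega> = (\<Sum>c\<in>I0\<times>J0. X c \<omega> - expectation (X c))" for \<omega>
  have Z: "integrable P (\<lambda>\<omega>. (Z \<omega>)\<^sup>2)" "expectation (\<lambda>\<omega>. (Z \<omega>)\<^sup>2) \<le> C * real (m * n)"
    "Z \<in> borel_measurable P"
    using expectation_centered_sum_square[OF anomalous_subset_grid, of "\<lambda>x. x" C] anomalous_subset_grid integrable_square expectation_square
    by (auto simp: Z_def[abs_def] card_cartesian_product I0 J0 subset_iff)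
  have "prob {\<omega> \<in> space P. Z \<omega> \<le> - y} \<le> prob {\<omega> \<in> space P. y\<^sup>2 \<le> (Z \<omega>)\<^sup>2}"
  proof (rule finite_measure_mono)
    show "{\<omega> \<in> space P. Z \<omega> \<le> - y} \<subseteq> {\<omega> \<in> space P. y\<^sup>2 \<le> (Z \<omega>)\<^sup>2}"
    proof safe
      fix \<omega> assume "Z \<omega> \<le> - y"
      then show "y\<^sup>2 \<le> (Z \<omega>)\<^sup>2" using power_mono[of y "- Z \<omega>" 2] assms by simp
    qed
  qed (use Z(3) in measurable)
  also have "\<dots> \<le> C * real (m * n) / y\<^sup>2"
    by (rule prob_ge_le_expectation) (use Z assms in auto)
  finally show ?thesis unfolding Z_def .
qed

text \<open>Absolute values per row give one random variable that dominates the fluctuation over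
  every subset of the elevated rows, so no union bound is taken. The mean absolute fluctuation of a
  row is at most the root of its second moment, and Markov's inequality follows.\<close>

lemma prob_anomalous_rows_large:
  assumes "0 < y"
  shows "prob {\<omega> \<in> space P. y \<le> (\<Sum>i\<in>I0. \<bar>\<Sum>j\<in>J0. V (i, j) \<omega> - expectation (V (i, j))\<bar>)}
    \<le> real m * (sqrt (C * real n) * t) / y"
proof (rule prob_ge_le_expectation)
  define R where "R i \<omega> = (\<Sum>j\<in>J0. V (i, j) \<omega> - expectation (V (i, j)))" for i \<omega>
  have R: "integrable P (\<lambda>\<omega>. \<bar>R i \<omega>\<bar>)" "expectation (\<lambda>\<omega>. \<bar>R i \<omega>\<bar>) \<le> sqrt (C * real n) * t" if i: "i \<in> I0" for i
  proof -
    have sub': "{i} \<times> J0 \<subseteq> grid M N" using anomalous_subset_grid i by auto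
    have R_eq: "R i = (\<lambda>\<omega>. \<Sum>c\<in>{i}\<times>J0. V c \<omega> - expectation (V c))"
      unfolding R_def using sum.cartesian_product[of "\<lambda>i j. V (i, j) _ - expectation (V (i, j))" J0 "{i}"]
      by (simp add: case_prod_unfold)
    have sq: "integrable P (\<lambda>\<omega>. (R i \<omega>)\<^sup>2)" "expectation (\<lambda>\<omega>. (R i \<omega>)\<^sup>2) \<le> (C * t\<^sup>2) * real n"
      and meas: "R i \<in> borel_measurable P"
      using expectation_centered_sum_square[OF sub', of "\<lambda>x. exp (t * x) - 1" "C * t\<^sup>2"] sub'
        integrable_V_square expectation_V_square
      by (auto simp: R_eq card_cartesian_product J0 subset_iff V_def[abs_def])
    show int: "integrable P (\<lambda>\<omega>. \<bar>R i \<omega>\<bar>)"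
      using square_integrable_imp_integrable[OF meas sq(1)] by simp
    \<comment> \<open>Jensen's inequality for the square, from nonnegativity of the variance of the
      absolute value.\<close>
    have "(expectation (\<lambda>\<omega>. \<bar>R i \<omega>\<bar>))\<^sup>2 \<le> expectation (\<lambda>\<omega>. (R i \<omega>)\<^sup>2)"
      using variance_eq[OF int] sq(1) variance_positive[of "\<lambda>\<omega>. \<bar>R i \<omega>\<bar>"] by simp
    also have "\<dots> \<le> (sqrt (C * real n) * t)\<^sup>2"
      using sq(2) C_nonneg by (simp add: power_mult_distrib algebra_simps)
    finally show "expectation (\<lambda>\<omega>. \<bar>R i \<omega>\<bar>) \<le> sqrt (C * real n) * t"
      by (rule power2_le_imp_le) (use t C_nonneg in auto)
  qed
  show "integrable P (\<lambda>\<omega>. \<Sum>i\<in>I0. \<bar>\<Sum>j\<in>J0. V (i, j) \<omega> - expectation (V (i, j))\<bar>)"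
    using R(1) by (auto simp: R_def)
  have "expectation (\<lambda>\<omega>. \<Sum>i\<in>I0. \<bar>R i \<omega>\<bar>) = (\<Sum>i\<in>I0. expectation (\<lambda>\<omega>. \<bar>R i \<omega>\<bar>))"
    using R(1) by (rule Bochner_Integration.integral_sum)
  also have "\<dots> \<le> real m * (sqrt (C * real n) * t)"
    using sum_bounded_above[of I0 _ "sqrt (C * real n) * t"] R(2) I0 by simp
  finally show "expectation (\<lambda>\<omega>. \<Sum>i\<in>I0. \<bar>\<Sum>j\<in>J0. V (i, j) \<omega> - expectation (V (i, j))\<bar>)
      \<le> real m * (sqrt (C * real n) * t)" unfolding R_def .
qed (use assms in \<open>auto intro!: sum_nonneg\<close>)

text \<open>\<open>t * X > 1\<close> forces \<open>X > 1 / t \<ge> 1\<close>, hence a weight of at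
  least \<open>exp (d / t)\<close>; Markov's inequality and a union over all cells finish.\<close>

lemma prob_entry_large:
  "prob {\<omega> \<in> space P. \<exists>c\<in>grid M N. 1 < t * X c \<omega>} \<le> real (M * N) * (C * exp (- d / t))"
proof -
  have one: "prob {\<omega> \<in> space P. 1 < t * X c \<omega>} \<le> C * exp (- d / t)" if c: "c \<in> grid M N" for c
  proof -
    have "prob {\<omega> \<in> space P. 1 < t * X c \<omega>} \<le> prob {\<omega> \<in> space P. exp (d / t) \<le> tilted_square d (X c \<omega>)}"
    proof (rule finite_measure_mono)
      show "{\<omega> \<in> space P. 1 < t * X c \<omega>} \<subseteq> {\<omega> \<in> space P. exp (d / t) \<le> tilted_square d (X c \<omega>)}"
      proof safe
        fix \<omega> assume "1 < t * X c \<omega>"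
        then have x: "1 / t < X c \<omega>" using t by (simp add: field_simps)
        moreover have "1 \<le> 1 / t" using t by simp
        ultimately have x1: "1 \<le> X c \<omega>" by linarith
        have "d * (1 / t) \<le> d * max (X c \<omega>) 0" using x t by (intro mult_left_mono) auto
        then have "1 * exp (d / t) \<le> (X c \<omega>)\<^sup>2 * exp (d * max (X c \<omega>) 0)"
          using x1 by (intro mult_mono) auto
        then show "exp (d / t) \<le> tilted_square d (X c \<omega>)" by (simp add: tilted_square_def)
      qed
    qed (use c in measurable)
    also have "\<dots> \<le> C / exp (d / t)"
      by (rule prob_ge_le_expectation) (use c moment in \<open>auto simp: tilted_square_nonneg\<close>)
    finally show ?thesis by (simp add: exp_minus field_simps)
  qed
  have "{\<omega> \<in> space P. \<exists>c\<in>grid M N. 1 < t * X c \<omega>} = (\<Union>c\<in>grid M N. {\<omega> \<in> space P. 1 < t * X c \<omega>})" by auto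
  also have "prob \<dots> \<le> (\<Sum>c\<in>grid M N. prob {\<omega> \<in> space P. 1 < t * X c \<omega>})"
    by (rule finite_measure_subadditive_finite) (auto simp: finite_grid)
  also have "\<dots> \<le> real (M * N) * (C * exp (- d / t))"
    using sum_bounded_above[of "grid M N" _ "C * exp (- d / t)"] one
    by (simp add: grid_def card_cartesian_product)
  finally show ?thesis .
qed

text \<open>\<open>V\<close> with the exponent truncated at \<open>1\<close>. Its values lie between
  \<open>-1\<close> and \<open>2\<close>, so it has all exponential moments, which \<open>V\<close>
  need not have; the two agree unless \<open>t * X > 1\<close>.\<close>

definition U :: "nat \<times> nat \<Rightarrow> 'a \<Rightarrow> real" where
  "U c \<omega> = exp (min (t * X c \<omega>) 1) - 1"

text \<open>The quadratic bound for the exponential with \<open>s * U \<le> 2\<close>, then passage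
  from \<open>U\<close> to \<open>V\<close>, which dominates it both in value and in square, and
  finally \<open>1 + y \<le> exp y\<close>. The second moment carries an extra factor
  \<open>s\<close>, so it is negligible against the mean for small \<open>s\<close>.\<close>

lemma expectation_exp_U:
  assumes c: "c \<in> grid M N" and s: "0 \<le> s" "s \<le> 1" and mean: "expectation (V c) \<le> k * t\<^sup>2"
  shows "integrable P (\<lambda>\<omega>. exp (s * U c \<omega>))"
    and "expectation (\<lambda>\<omega>. exp (s * U c \<omega>)) \<le> exp (s * t\<^sup>2 * (k + 4 * s * C))"
proof -
  have [measurable]: "U c \<in> borel_measurable P" unfolding U_def using c by measurable
  have e: "exp 1 \<le> (3::real)" using exp_le by simp
  have Ub: "U c \<omega> \<le> 2" "-1 \<le> U c \<omega>" "U c \<omega> \<le> V c \<omega>" "(U c \<omega>)\<^sup>2 \<le> (V c \<omega>)\<^sup>2" for \<omega>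
  proof -
    have "exp (min (t * X c \<omega>) 1) \<le> exp 1" by simp
    then show "U c \<omega> \<le> 2" unfolding U_def using e by linarith
    show "-1 \<le> U c \<omega>" unfolding U_def by simp
    show "U c \<omega> \<le> V c \<omega>" unfolding U_def V_def by simp
    have "\<bar>U c \<omega>\<bar> \<le> \<bar>V c \<omega>\<bar>" unfolding U_def V_def by (cases "t * X c \<omega> \<le> 1") auto
    then show "(U c \<omega>)\<^sup>2 \<le> (V c \<omega>)\<^sup>2" by (simp add: abs_le_square_iff)
  qed
  have sU: "s * U c \<omega> \<le> 2" for \<omega>
    using mult_left_mono[OF Ub(1)[of \<omega>] s(1)] s(2) by linarith
  show int: "integrable P (\<lambda>\<omega>. exp (s * U c \<omega>))"
  proof (rule integrable_const_bound[where B = "exp 2"])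
    show "AE \<omega> in P. norm (exp (s * U c \<omega>)) \<le> exp 2" using sU by simp
  qed measurable
  have pt: "exp (s * U c \<omega>) \<le> 1 + s * V c \<omega> + 4 * s\<^sup>2 * (V c \<omega>)\<^sup>2" for \<omega>
  proof -
    have "max (s * U c \<omega>) 0 \<le> 2" using sU by simp
    then have "exp (max (s * U c \<omega>) 0) \<le> exp (1 + 1)" by simp
    also have "exp (1 + 1) = exp 1 * exp (1 :: real)" by (rule exp_add)
    \<comment> \<open>Since \<open>2.8 * 2.8 = 7.84\<close>, the remainder factor is at most
      \<open>8\<close>, half of which is the constant \<open>4\<close> of the bound.\<close>
    also have "\<dots> \<le> 2.8 * 2.8" using e_less_272 by (intro mult_mono) auto
    finally have ex: "exp (max (s * U c \<omega>) 0) \<le> 8" by simp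
    have "exp (s * U c \<omega>) \<le> 1 + s * U c \<omega> + (s * U c \<omega>)\<^sup>2 / 2 * exp (max (s * U c \<omega>) 0)"
      by (rule exp_le_quadratic)
    also have "\<dots> \<le> 1 + s * U c \<omega> + (s * U c \<omega>)\<^sup>2 / 2 * 8"
      by (intro add_left_mono mult_left_mono ex) auto
    also have "\<dots> = 1 + s * U c \<omega> + 4 * s\<^sup>2 * (U c \<omega>)\<^sup>2" by (simp add: power_mult_distrib)
    also have "\<dots> \<le> 1 + s * V c \<omega> + 4 * s\<^sup>2 * (V c \<omega>)\<^sup>2"
      by (intro add_mono mult_left_mono Ub s order.refl) auto
    finally show ?thesis .
  qed
  have "expectation (\<lambda>\<omega>. exp (s * U c \<omega>)) \<le> expectation (\<lambda>\<omega>. 1 + s * V c \<omega> + 4 * s\<^sup>2 * (V c \<omega>)\<^sup>2)"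
    by (rule integral_mono[OF int _ pt]) (use integrable_V[OF c] integrable_V_square[OF c] in auto)
  also have "\<dots> = 1 + s * expectation (V c) + 4 * s\<^sup>2 * expectation (\<lambda>\<omega>. (V c \<omega>)\<^sup>2)"
    using integrable_V[OF c] integrable_V_square[OF c] by (simp add: prob_space)
  also have "\<dots> \<le> 1 + s * (k * t\<^sup>2) + 4 * s\<^sup>2 * (C * t\<^sup>2)"
    by (intro add_mono mult_left_mono mean expectation_V_square c s order.refl) auto
  also have "\<dots> = 1 + s * t\<^sup>2 * (k + 4 * s * C)" by (simp add: algebra_simps power2_eq_square)
  also have "\<dots> \<le> exp (s * t\<^sup>2 * (k + 4 * s * C))" by (rule exp_ge_add_one_self)
  finally show "expectation (\<lambda>\<omega>. exp (s * U c \<omega>)) \<le> exp (s * t\<^sup>2 * (k + 4 * s * C))" .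
qed

text \<open>Chernoff's method: by independence the exponential moment of the sum is a product with
  one common bound per cell.\<close>

lemma prob_truncated_sum_large:
  assumes D: "D \<subseteq> grid M N" and s: "0 < s" "s \<le> 1"
    and mean: "\<And>c. c \<in> D \<Longrightarrow> expectation (V c) \<le> k * t\<^sup>2"
  shows "prob {\<omega> \<in> space P. y \<le> (\<Sum>c\<in>D. U c \<omega>)}
    \<le> exp (real (card D) * (s * t\<^sup>2 * (k + 4 * s * C)) - s * y)"
proof -
  have finD: "finite D" using D finite_grid finite_subset by blast
  have ind: "indep_vars (\<lambda>_. borel) (\<lambda>c \<omega>. exp (s * U c \<omega>)) D"
    unfolding U_def by (rule indep_vars_compose2[OF indep_vars_subset[OF indep D]]) measurable
  have int: "integrable P (\<lambda>\<omega>. exp (s * U c \<omega>))"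
    and ex: "expectation (\<lambda>\<omega>. exp (s * U c \<omega>)) \<le> exp (s * t\<^sup>2 * (k + 4 * s * C))" if "c \<in> D" for c
    using expectation_exp_U[of c s k] that D s mean[OF that] by auto
  have "prob {\<omega> \<in> space P. y \<le> (\<Sum>c\<in>D. U c \<omega>)} = prob {\<omega> \<in> space P. exp (s * y) \<le> (\<Prod>c\<in>D. exp (s * U c \<omega>))}"
    using s finD by (simp add: exp_sum[symmetric] sum_distrib_left[symmetric])
  also have "\<dots> \<le> exp (s * t\<^sup>2 * (k + 4 * s * C)) ^ card D / exp (s * y)"
  proof (rule prob_ge_le_expectation)
    show "integrable P (\<lambda>\<omega>. \<Prod>c\<in>D. exp (s * U c \<omega>))"
      using indep_vars_integrable[OF finD ind int] .
    have "expectation (\<lambda>\<omega>. \<Prod>c\<in>D. exp (s * U c \<omega>)) = (\<Prod>c\<in>D. expectation (\<lambda>\<omega>. exp (s * U c \<omega>)))"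
      using indep_vars_lebesgue_integral[OF finD ind int] .
    also have "\<dots> \<le> (\<Prod>c\<in>D. exp (s * t\<^sup>2 * (k + 4 * s * C)))"
      using ex by (intro prod_mono) (auto intro!: integral_nonneg_AE)
    finally show "expectation (\<lambda>\<omega>. \<Prod>c\<in>D. exp (s * U c \<omega>)) \<le> exp (s * t\<^sup>2 * (k + 4 * s * C)) ^ card D"
      by simp
  qed (auto intro: prod_nonneg)
  also have "\<dots> = exp (real (card D) * (s * t\<^sup>2 * (k + 4 * s * C)) - s * y)"
    by (simp only: exp_of_nat_mult exp_diff)
  finally show ?thesis .
qed

text \<open>A deterministic decomposition: if no entry exceeds the truncation, \<open>V = U\<close>
  off the elevated block. On the rows in \<open>I \<inter> I0\<close> the sum is split into
  fluctuation and mean; absolute row fluctuations and nonnegative means only grow when extended to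
  all of \<open>I0\<close>, so the last two terms do not depend on \<open>I\<close>.\<close>

lemma block_sum_le:
  assumes I: "I \<subseteq> {1..M}"
    and mean: "\<And>c. c \<in> I0 \<times> J0 \<Longrightarrow> 0 \<le> expectation (X c)"
    and small: "\<And>c. c \<in> grid M N \<Longrightarrow> t * X c \<omega> \<le> 1"
  shows "(\<Sum>i\<in>I. \<Sum>j\<in>{1..N}. exp (t * X (i, j) \<omega>) - 1) \<le>
    (\<Sum>c\<in>I\<times>{1..N} - I0\<times>J0. U c \<omega>)
    + (\<Sum>i\<in>I0. \<bar>\<Sum>j\<in>J0. V (i, j) \<omega> - expectation (V (i, j))\<bar>)
    + (\<Sum>c\<in>I0\<times>J0. expectation (V c))"
proof -
  have finI: "finite I" using I finite_subset by blast
  have split: "I\<times>{1..N} = (I\<times>{1..N} - I0\<times>J0) \<union> (I\<inter>I0)\<times>J0" using J0 by auto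
  have EV: "0 \<le> expectation (V c)" if c: "c \<in> I0 \<times> J0" for c
  proof -
    have "0 \<le> t * expectation (X c)" using mean[OF c] t by simp
    then show ?thesis using expectation_V_ge[of c] c anomalous_subset_grid by auto
  qed
  have "(\<Sum>i\<in>I. \<Sum>j\<in>{1..N}. exp (t * X (i, j) \<omega>) - 1) = (\<Sum>c\<in>I\<times>{1..N}. V c \<omega>)"
    unfolding sum.cartesian_product V_def by (simp add: case_prod_unfold)
  also have "\<dots> = (\<Sum>c\<in>I\<times>{1..N} - I0\<times>J0. V c \<omega>) + (\<Sum>c\<in>(I\<inter>I0)\<times>J0. V c \<omega>)"
    by (subst split, rule sum.union_disjoint) (use finI finite_anomalous in auto)
  also have "(\<Sum>c\<in>I\<times>{1..N} - I0\<times>J0. V c \<omega>) = (\<Sum>c\<in>I\<times>{1..N} - I0\<times>J0. U c \<omega>)"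
  proof (rule sum.cong)
    fix c assume "c \<in> I\<times>{1..N} - I0\<times>J0"
    then have "c \<in> grid M N" using I by (auto simp: grid_def)
    then show "V c \<omega> = U c \<omega>" unfolding U_def V_def using small by simp
  qed simp
  also have "(\<Sum>c\<in>(I\<inter>I0)\<times>J0. V c \<omega>) = (\<Sum>c\<in>(I\<inter>I0)\<times>J0. V c \<omega> - expectation (V c)) + (\<Sum>c\<in>(I\<inter>I0)\<times>J0. expectation (V c))"
    by (simp add: sum_subtractf)
  also have "(\<Sum>c\<in>(I\<inter>I0)\<times>J0. expectation (V c)) \<le> (\<Sum>c\<in>I0\<times>J0. expectation (V c))"
    by (rule sum_mono2) (use finite_anomalous EV in auto)
  also have "(\<Sum>c\<in>(I\<inter>I0)\<times>J0. V c \<omega> - expectation (V c)) = (\<Sum>i\<in>I\<inter>I0. \<Sum>j\<in>J0. V (i, j) \<omega> - expectation (V (i, j)))"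
    unfolding sum.cartesian_product by (simp add: case_prod_unfold)
  also have "\<dots> \<le> (\<Sum>i\<in>I\<inter>I0. \<bar>\<Sum>j\<in>J0. V (i, j) \<omega> - expectation (V (i, j))\<bar>)"
    by (rule sum_mono) simp
  also have "\<dots> \<le> (\<Sum>i\<in>I0. \<bar>\<Sum>j\<in>J0. V (i, j) \<omega> - expectation (V (i, j))\<bar>)"
    by (rule sum_mono2) (use finite_anomalous in auto)
  finally show ?thesis by simp
qed

text \<open>The choice of \<open>s\<close> makes the quadratic term \<open>4 * s * C\<close> at most
  \<open>e\<close>. The threshold exceeds the mean bound \<open>k\<close> by \<open>2 * e\<close>,
  so a margin \<open>e\<close> is left in the exponent to beat the number of row sets in the union
  bound.\<close>

lemma prob_some_block_large:
  assumes s: "0 < s" "s \<le> 1" "4 * s * C \<le> e" and k: "0 \<le> k"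
    and mean: "\<And>c. c \<in> grid M N - I0 \<times> J0 \<Longrightarrow> expectation (V c) \<le> k * t\<^sup>2"
  shows "prob {\<omega> \<in> space P. \<exists>I\<in>{I. I \<subseteq> {1..M} \<and> card I = m}.
      real m * real N * (t\<^sup>2 * (k + 2 * e)) \<le> (\<Sum>c\<in>I\<times>{1..N} - I0\<times>J0. U c \<omega>)}
    \<le> real (M choose m) * exp (- s * e * (real m * real N * t\<^sup>2))"
proof -
  define F where "F I = {\<omega> \<in> space P. real m * real N * (t\<^sup>2 * (k + 2 * e)) \<le> (\<Sum>c\<in>I\<times>{1..N} - I0\<times>J0. U c \<omega>)}" for I
  have D: "I\<times>{1..N} - I0\<times>J0 \<subseteq> grid M N - I0 \<times> J0" if "I \<subseteq> {1..M}" for I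
    using that by (auto simp: grid_def)
  have meas: "F I \<in> sets P" if I: "I \<subseteq> {1..M}" for I
  proof -
    have "X c \<in> borel_measurable P" if "c \<in> I\<times>{1..N} - I0\<times>J0" for c
      using D[OF I] that by auto
    then have [measurable]: "(\<lambda>\<omega>. \<Sum>c\<in>I\<times>{1..N} - I0\<times>J0. U c \<omega>) \<in> borel_measurable P"
      unfolding U_def by (intro borel_measurable_sum) auto
    show ?thesis unfolding F_def by measurable
  qed
  have e: "0 \<le> e" using s C_nonneg by (meson mult_nonneg_nonneg order.trans less_imp_le zero_le_numeral)
  have one: "prob (F I) \<le> exp (- s * e * (real m * real N * t\<^sup>2))" if I: "I \<subseteq> {1..M}" "card I = m" for I
  proof -
    let ?D = "I\<times>{1..N} - I0\<times>J0"
    have finI: "finite I" using I finite_subset by blast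
    have "real (card ?D) \<le> real (card (I \<times> {1..N}))"
      by (intro of_nat_mono card_mono) (use finI in auto)
    then have cD: "real (card ?D) \<le> real m * real N" using I by (simp add: card_cartesian_product)
    have "prob (F I) \<le> exp (real (card ?D) * (s * t\<^sup>2 * (k + 4 * s * C)) - s * (real m * real N * (t\<^sup>2 * (k + 2 * e))))"
      unfolding F_def by (rule prob_truncated_sum_large) (use D[OF I(1)] s mean in auto)
    also have "\<dots> \<le> exp (- s * e * (real m * real N * t\<^sup>2))"
    proof -
      have "real (card ?D) * (s * t\<^sup>2 * (k + 4 * s * C)) \<le> real m * real N * (s * t\<^sup>2 * (k + e))"
        by (intro mult_mono cD) (use s k C_nonneg e in auto)
      then show ?thesis by (simp add: algebra_simps)
    qed
    finally show ?thesis .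
  qed
  have "{\<omega> \<in> space P. \<exists>I\<in>{I. I \<subseteq> {1..M} \<and> card I = m}.
      real m * real N * (t\<^sup>2 * (k + 2 * e)) \<le> (\<Sum>c\<in>I\<times>{1..N} - I0\<times>J0. U c \<omega>)}
      = (\<Union>I\<in>{I. I \<subseteq> {1..M} \<and> card I = m}. F I)" unfolding F_def by auto
  also have "prob \<dots> \<le> (\<Sum>I\<in>{I. I \<subseteq> {1..M} \<and> card I = m}. prob (F I))"
    by (rule finite_measure_subadditive_finite) (use meas in auto)
  also have "\<dots> \<le> real (card {I. I \<subseteq> {1..M} \<and> card I = m}) * exp (- s * e * (real m * real N * t\<^sup>2))"
    using one by (intro sum_bounded_above) auto
  finally show ?thesis by (simp add: n_subsets)
qed

text \<open>Outside four exceptional events, \<open>B\<close> bounds the row sums and the observed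
  sum is large, so \<open>perm_pvalue_le\<close> applies. The signal also raises the permutation
  average, by the fraction \<open>n / N\<close> of its size; hence the factor
  \<open>1 - n / N\<close> in the exponent.\<close>

lemma prob_perm_pvalue_le:
  assumes G: "G = row_perms \<or> G = all_perms"
    and s: "0 < s" "s \<le> 1" "4 * s * C \<le> e" and e: "0 < e" and k: "0 \<le> k"
    and null: "\<And>c. c \<in> grid M N - I0 \<times> J0 \<Longrightarrow> expectation (V c) \<le> k * t\<^sup>2"
    and signal: "\<And>c. c \<in> I0 \<times> J0 \<Longrightarrow> a \<le> expectation (X c)" and a: "0 \<le> a"
  shows "1 - (real (M * N) * (C * exp (- d / t))
      + real (M choose m) * exp (- s * e * (real m * real N * t\<^sup>2))
      + sqrt (C * real n) / (e * real N * t)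
      + C / (e\<^sup>2 * (real m * real n * t\<^sup>2)))
    \<le> prob {\<omega> \<in> space P. perm_pvalue (G M N) M N m n (\<lambda>c. X c \<omega>) \<le>
        real (M choose m) * real (N choose n) *
        exp (real m * real n * (t\<^sup>2 * (k + 4 * e + C * (real n / real N)) - t * a * (1 - real n / real N)))}"
    (is "1 - (?p1 + ?p2 + ?p3 + ?p4) \<le> prob ?A")
proof -
  have N0: "real N > 0" "real M > 0" and m0: "real m > 0" "real n > 0" using pos size_le by auto
  \<comment> \<open>The exceptional events: an entry beyond the truncation, a large null sum over
    some row set, large fluctuations on the elevated rows, and an observed sum far below its
    mean.\<close>
  define E1 where "E1 = {\<omega> \<in> space P. \<exists>c\<in>grid M N. 1 < t * X c \<omega>}"
  define E2 where "E2 = {\<omega> \<in> space P. \<exists>I\<in>{I. I \<subseteq> {1..M} \<and> card I = m}.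
      real m * real N * (t\<^sup>2 * (k + 2 * e)) \<le> (\<Sum>c\<in>I\<times>{1..N} - I0\<times>J0. U c \<omega>)}"
  define E3 where "E3 = {\<omega> \<in> space P. real m * real N * (t\<^sup>2 * e) \<le> (\<Sum>i\<in>I0. \<bar>\<Sum>j\<in>J0. V (i, j) \<omega> - expectation (V (i, j))\<bar>)}"
  define E4 where "E4 = {\<omega> \<in> space P. (\<Sum>c\<in>I0\<times>J0. X c \<omega> - expectation (X c)) \<le> - (real m * real n * (t * e))}"
  have mI: "X (i, j) \<in> borel_measurable P" if "i \<in> {1..M}" "j \<in> {1..N}" for i j
    using that by (simp add: grid_def)
  have E1_sets: "E1 \<in> sets P"
  proof -
    have "E1 = (\<Union>c\<in>grid M N. {\<omega> \<in> space P. 1 < t * X c \<omega>})" unfolding E1_def by auto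
    then show ?thesis by (auto simp: finite_grid intro!: sets.finite_UN)
  qed
  have E2_sets: "E2 \<in> sets P"
  proof -
    have U': "(\<lambda>\<omega>. \<Sum>c\<in>I\<times>{1..N} - I0\<times>J0. U c \<omega>) \<in> borel_measurable P" if "I \<subseteq> {1..M}" for I
      unfolding U_def using mI that by (intro borel_measurable_sum) auto
    have "E2 = (\<Union>I\<in>{I. I \<subseteq> {1..M} \<and> card I = m}. {\<omega> \<in> space P. 
      real m * real N * (t\<^sup>2 * (k + 2 * e)) \<le> (\<Sum>c\<in>I\<times>{1..N} - I0\<times>J0. U c \<omega>)})" unfolding E2_def by auto
    then show ?thesis using U' by (auto intro!: sets.finite_UN)
  qed
  have VX: "V (i, j) \<in> borel_measurable P" "X (i, j) \<in> borel_measurable P" if "i \<in> I0" "j \<in> J0" for i j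
    using anomalous_subset_grid that by auto
  have E3_sets: "E3 \<in> sets P"
  proof -
    have "(\<lambda>\<omega>. \<Sum>i\<in>I0. \<bar>\<Sum>j\<in>J0. V (i, j) \<omega> - expectation (V (i, j))\<bar>) \<in> borel_measurable P"
      using VX by (intro borel_measurable_sum borel_measurable_abs borel_measurable_diff) auto
    then show ?thesis unfolding E3_def by measurable
  qed
  have E4_sets: "E4 \<in> sets P"
  proof -
    have "(\<lambda>\<omega>. \<Sum>c\<in>I0\<times>J0. X c \<omega> - expectation (X c)) \<in> borel_measurable P"
      using VX by (intro borel_measurable_sum borel_measurable_diff) auto
    then show ?thesis unfolding E4_def by measurable
  qed
  have p1: "prob E1 \<le> ?p1" unfolding E1_def by (rule prob_entry_large)
  have p2: "prob E2 \<le> ?p2" unfolding E2_def by (rule prob_some_block_large) (use s k null in auto)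
  have p3: "prob E3 \<le> ?p3"
  proof -
    have "prob E3 \<le> real m * (sqrt (C * real n) * t) / (real m * real N * (t\<^sup>2 * e))"
      unfolding E3_def by (rule prob_anomalous_rows_large) (use N0 m0 t e in simp)
    also have "\<dots> = ?p3" using m0 t e by (simp add: field_simps power2_eq_square)
    finally show ?thesis .
  qed
  have p4: "prob E4 \<le> ?p4"
  proof -
    have "prob E4 \<le> C * real (m * n) / (real m * real n * (t * e))\<^sup>2"
      unfolding E4_def by (rule prob_anomalous_sum_small) (use m0 t e in simp)
    also have "\<dots> = ?p4" using m0 t e by (simp add: field_simps power2_eq_square)
    finally show ?thesis .
  qed
  have A_sets: "?A \<in> sets P"
  proof -
    have "(\<lambda>\<omega>. perm_pvalue (G M N) M N m n (\<lambda>c. X c \<omega>)) \<in> borel_measurable P"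
      by (rule borel_measurable_perm_pvalue) (use perms_subset_all_perms[OF G] in auto)
    then show ?thesis by measurable
  qed
  have "space P - ?A \<subseteq> E1 \<union> E2 \<union> E3 \<union> E4"
  proof
    fix \<omega> assume \<omega>: "\<omega> \<in> space P - ?A"
    show "\<omega> \<in> E1 \<union> E2 \<union> E3 \<union> E4"
    proof (rule ccontr)
      assume good: "\<omega> \<notin> E1 \<union> E2 \<union> E3 \<union> E4"
      have sp: "\<omega> \<in> space P" using \<omega> by simp
      define \<mu> where "\<mu> = (\<Sum>c\<in>I0\<times>J0. expectation (X c))"
      define S where "S = (\<Sum>i\<in>I0. \<Sum>j\<in>J0. X (i, j) \<omega>)"
      \<comment> \<open>Of \<open>3 * e\<close>, two parts come from the null sums and one from the
        row fluctuations; the last two terms bound the means of \<open>V\<close> on the elevated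
        block.\<close>
      define B where "B = real m * real N * (t\<^sup>2 * (k + 3 * e)) + t * \<mu> + C / 2 * (real m * real n * t\<^sup>2)"
      have card_S: "real (card (I0 \<times> J0)) = real m * real n"
        by (simp add: card_cartesian_product I0 J0)
      have \<mu>: "real m * real n * a \<le> \<mu>"
        using sum_bounded_below[of "I0\<times>J0" a "\<lambda>c. expectation (X c)"] signal card_S by (auto simp: \<mu>_def)
      have EV: "(\<Sum>c\<in>I0\<times>J0. expectation (V c)) \<le> t * \<mu> + C / 2 * (real m * real n * t\<^sup>2)"
      proof -
        have "(\<Sum>c\<in>I0\<times>J0. expectation (V c)) \<le> (\<Sum>c\<in>I0\<times>J0. t * expectation (X c) + C / 2 * t\<^sup>2)"
          using anomalous_subset_grid by (intro sum_mono expectation_V_le) auto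
        also have "\<dots> = t * \<mu> + C / 2 * (real m * real n * t\<^sup>2)"
          by (simp add: sum.distrib \<mu>_def sum_distrib_left card_cartesian_product I0 J0)
        finally show ?thesis .
      qed
      have S: "\<mu> - real m * real n * (t * e) \<le> S"
      proof -
        have "(\<Sum>c\<in>I0\<times>J0. X c \<omega> - expectation (X c)) = S - \<mu>"
          unfolding S_def \<mu>_def sum.cartesian_product by (simp add: case_prod_unfold sum_subtractf)
        then show ?thesis using good sp by (auto simp: E4_def)
      qed
      have "perm_pvalue (G M N) M N m n (\<lambda>c. X c \<omega>) \<le> real (M choose m) * real (N choose n) *
          exp (real n / real N * B - t * (\<Sum>i\<in>I0. \<Sum>j\<in>J0. X (i, j) \<omega>))"
      proof (rule perm_pvalue_le[OF G])
        fix I assume I: "I \<subseteq> {1..M}" "card I = m"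
        have "(\<Sum>i\<in>I. \<Sum>j\<in>{1..N}. exp (t * X (i, j) \<omega>) - 1) \<le>
          (\<Sum>c\<in>I\<times>{1..N} - I0\<times>J0. U c \<omega>)
          + (\<Sum>i\<in>I0. \<bar>\<Sum>j\<in>J0. V (i, j) \<omega> - expectation (V (i, j))\<bar>)
          + (\<Sum>c\<in>I0\<times>J0. expectation (V c))"
        proof (rule block_sum_le[OF I(1)])
          show "0 \<le> expectation (X c)" if "c \<in> I0 \<times> J0" for c using signal[OF that] a by simp
          show "t * X c \<omega> \<le> 1" if "c \<in> grid M N" for c
            using good sp that by (force simp: E1_def)
        qed
        also have "(\<Sum>c\<in>I\<times>{1..N} - I0\<times>J0. U c \<omega>) \<le> real m * real N * (t\<^sup>2 * (k + 2 * e))"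
          using good sp I by (force simp: E2_def)
        also have "(\<Sum>i\<in>I0. \<bar>\<Sum>j\<in>J0. V (i, j) \<omega> - expectation (V (i, j))\<bar>) \<le> real m * real N * (t\<^sup>2 * e)"
          using good sp by (force simp: E3_def)
        also note EV
        finally show "(\<Sum>i\<in>I. \<Sum>j\<in>{1..N}. exp (t * X (i, j) \<omega>) - 1) \<le> B"
          by (simp add: B_def algebra_simps)
      qed (use pos size_le t I0 J0 in auto)
      also have "real n / real N * B - t * (\<Sum>i\<in>I0. \<Sum>j\<in>J0. X (i, j) \<omega>)
          \<le> real m * real n * (t\<^sup>2 * (k + 4 * e + C * (real n / real N)) - t * a * (1 - real n / real N))"
      proof -
        define r where "r = real n / real N"
        have r: "0 \<le> r" "r \<le> 1" and rN: "r * real N = real n" using N0 size_le by (auto simp: r_def)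
        have "r * B = real m * (r * real N) * (t\<^sup>2 * (k + 3 * e)) + r * t * \<mu> + C / 2 * r * (real m * real n * t\<^sup>2)"
          by (simp add: B_def algebra_simps)
        also have "\<dots> = real m * real n * (t\<^sup>2 * (k + 3 * e)) + r * t * \<mu> + C / 2 * r * (real m * real n * t\<^sup>2)"
          by (simp add: rN)
        finally have rB: "r * B = \<dots>" .
        have tS: "t * (\<mu> - real m * real n * (t * e)) \<le> t * S" using S t by (intro mult_left_mono) auto
        have "t * (1 - r) * (real m * real n * a) \<le> t * (1 - r) * \<mu>"
          using \<mu> t r by (intro mult_left_mono) auto
        \<comment> \<open>This relaxes \<open>C / 2\<close> to \<open>C\<close>. The fourth
          \<open>e\<close> of the conclusion stems from the deviation of the observed sum, through
          \<open>tS\<close>.\<close>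
        moreover have "0 \<le> C / 2 * r * (real m * real n * t\<^sup>2)" using C_nonneg r by simp
        ultimately show ?thesis using rB tS unfolding r_def[symmetric] S_def[symmetric]
          by (simp add: algebra_simps power2_eq_square)
      qed
      finally have "perm_pvalue (G M N) M N m n (\<lambda>c. X c \<omega>) \<le> real (M choose m) * real (N choose n) *
        exp (real m * real n * (t\<^sup>2 * (k + 4 * e + C * (real n / real N)) - t * a * (1 - real n / real N)))"
        by (simp add: mult_left_mono)
      then show False using \<omega> by simp
    qed
  qed
  then have "prob (space P - ?A) \<le> prob (E1 \<union> E2 \<union> E3 \<union> E4)"
    using E1_sets E2_sets E3_sets E4_sets by (intro finite_measure_mono) auto
  also have "\<dots> \<le> prob E1 + prob E2 + prob E3 + prob E4"
    using E1_sets E2_sets E3_sets E4_sets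
    by (intro order.trans[OF measure_Un_le] add_mono order.refl) auto
  finally have "prob (space P - ?A) \<le> ?p1 + ?p2 + ?p3 + ?p4" using p1 p2 p3 p4 by linarith
  then show ?thesis using prob_compl[OF A_sets] by linarith
qed

end

section \<open>Exponential tilting\<close>

locale standardized_distribution = real_distribution \<nu> for \<nu> :: "real measure" +
  assumes integrable_id: "integrable \<nu> (\<lambda>x. x)" and mean_zero: "expectation (\<lambda>x. x) = 0"
    and integrable_square: "integrable \<nu> (\<lambda>x. x\<^sup>2)" and second_moment: "expectation (\<lambda>x. x\<^sup>2) = 1"
begin

lemma prob_UNIV [simp]: "prob UNIV = 1"
  using prob_space by simp

abbreviation \<phi> :: "real \<Rightarrow> real" where
  "\<phi> t \<equiv> expectation (\<lambda>x. exp (t * x))"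

lemma mgf_finite_iff: "mgf \<nu> t < \<infinity> \<longleftrightarrow> integrable \<nu> (\<lambda>x. exp (t * x))"
  unfolding mgf_def by (subst integrable_iff_bounded) simp

lemma mgf_eq: "integrable \<nu> (\<lambda>x. exp (t * x)) \<Longrightarrow> mgf \<nu> t = ennreal (\<phi> t)"
  unfolding mgf_def by (rule nn_integral_eq_integral) auto

text \<open>Integrate \<open>1 + t * x \<le> exp (t * x)\<close> against a law of mean zero. The
  bound keeps the normalising constant away from \<open>0\<close>, so division by it and its
  logarithm are harmless.\<close>

lemma phi_ge_1:
  assumes "integrable \<nu> (\<lambda>x. exp (t * x))" shows "1 \<le> \<phi> t"
proof -
  have "expectation (\<lambda>x. 1 + t * x) \<le> \<phi> t"
    by (rule integral_mono) (use assms integrable_id in auto)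
  then show ?thesis using integrable_id mean_zero by simp
qed

lemma tilt_density_eq:
  assumes "integrable \<nu> (\<lambda>x. exp (t * x))" shows "tilt_density \<nu> t x = exp (t * x) / \<phi> t"
  using phi_ge_1[OF assms] by (simp add: tilt_density_def mgf_eq[OF assms] exp_diff)

lemma integrable_exp_mono:
  assumes "integrable \<nu> (\<lambda>x. exp (t * x))" "0 \<le> s" "s \<le> t"
  shows "integrable \<nu> (\<lambda>x. exp (s * x))"
proof (rule Bochner_Integration.integrable_bound[where f = "\<lambda>x. 1 + exp (t * x)"])
  have "exp (s * x) \<le> 1 + exp (t * x)" for x
  proof (cases "x \<ge> 0")
    case True
    then have "exp (s * x) \<le> exp (t * x)" using assms by (simp add: mult_right_mono)
    then show ?thesis by linarith
  next
    case False
    then have "exp (s * x) \<le> 1" using assms by (simp add: mult_nonneg_nonpos)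
    then show ?thesis using exp_ge_zero[of "t * x"] by linarith
  qed
  then show "AE x in \<nu>. norm (exp (s * x)) \<le> norm (1 + exp (t * x))" by simp
qed (use assms in auto)

lemma integrable_exp_below_theta_star:
  assumes "0 \<le> s" "ereal s < theta_star \<nu>"
  obtains t where "s < t" "integrable \<nu> (\<lambda>x. exp (t * x))" "integrable \<nu> (\<lambda>x. exp (s * x))"
proof -
  obtain t where t: "0 < t" "mgf \<nu> t < \<infinity>" "s < t"
    using assms(2) unfolding theta_star_def less_Sup_iff by auto
  then have "integrable \<nu> (\<lambda>x. exp (t * x))" using mgf_finite_iff by blast
  then show ?thesis using that[of t] t assms integrable_exp_mono[of t s] by auto
qed

text \<open>The reserve \<open>w = u - d - \<theta>'\<close> in the exponent absorbs the factor
  \<open>x\<^sup>2\<close> for \<open>x \<ge> 0\<close>; for \<open>x < 0\<close> the tilt is at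
  most \<open>1\<close> and the second moment suffices. The bound is uniform in
  \<open>\<theta> \<le> \<theta>'\<close>.\<close>

lemma tilted_moment_bound:
  assumes u: "integrable \<nu> (\<lambda>x. exp (u * x))" and d: "0 \<le> d" and \<theta>: "0 \<le> \<theta>" "\<theta> \<le> \<theta>'" "d + \<theta>' < u"
  shows "integrable \<nu> (\<lambda>x. tilted_square d x * exp (\<theta> * x))"
    and "expectation (\<lambda>x. tilted_square d x * exp (\<theta> * x)) \<le> 1 + 2 / (u - d - \<theta>')\<^sup>2 * \<phi> u"
proof -
  define w where "w = u - d - \<theta>'"
  have w: "w > 0" using \<theta> by (simp add: w_def)
  have le: "tilted_square d x * exp (\<theta> * x) \<le> x\<^sup>2 + 2 / w\<^sup>2 * exp (u * x)" for x
  proof (cases "x \<ge> 0")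
    case True
    have "(w * x)\<^sup>2 / 2 \<le> exp (w * x)"
      using exp_lower_Taylor_quadratic[of "w * x"] mult_nonneg_nonneg[of w x] True w by linarith
    then have x2: "x\<^sup>2 \<le> 2 / w\<^sup>2 * exp (w * x)" using w by (simp add: field_simps)
    have "tilted_square d x * exp (\<theta> * x) \<le> x\<^sup>2 * exp (d * x) * exp (\<theta>' * x)"
      unfolding tilted_square_def using True \<theta> by (intro mult_mono) (auto intro: mult_right_mono)
    also have "\<dots> \<le> 2 / w\<^sup>2 * exp (w * x) * exp (d * x) * exp (\<theta>' * x)"
      by (intro mult_right_mono x2) auto
    also have "\<dots> = 2 / w\<^sup>2 * exp (u * x)" by (simp add: w_def exp_add[symmetric] algebra_simps)
    finally show ?thesis using zero_le_power2[of x] by linarith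
  next
    case False
    then have "exp (\<theta> * x) \<le> 1" using \<theta> by (simp add: mult_nonneg_nonpos)
    then have "tilted_square d x * exp (\<theta> * x) \<le> x\<^sup>2 * 1"
      unfolding tilted_square_def using False by (intro mult_mono) auto
    moreover have "0 \<le> 2 / w\<^sup>2 * exp (u * x)" by simp
    ultimately show ?thesis by linarith
  qed
  have int': "integrable \<nu> (\<lambda>x. x\<^sup>2 + 2 / w\<^sup>2 * exp (u * x))" using u integrable_square by simp
  show int: "integrable \<nu> (\<lambda>x. tilted_square d x * exp (\<theta> * x))"
    by (rule Bochner_Integration.integrable_bound[OF int'])
       (use le in \<open>auto simp: tilted_square_nonneg intro: order.trans[OF _ abs_ge_self]\<close>)
  have "expectation (\<lambda>x. tilted_square d x * exp (\<theta> * x)) \<le> expectation (\<lambda>x. x\<^sup>2 + 2 / w\<^sup>2 * exp (u * x))"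
    by (rule integral_mono[OF int int' le])
  also have "\<dots> = 1 + 2 / w\<^sup>2 * \<phi> u" using u integrable_square second_moment by simp
  finally show "expectation (\<lambda>x. tilted_square d x * exp (\<theta> * x)) \<le> 1 + 2 / (u - d - \<theta>')\<^sup>2 * \<phi> u"
    unfolding w_def .
qed

text \<open>By Lindelof, the open null sets have a countable subfamily with the same union, and that
  union contains the complement of the support.\<close>

lemma AE_in_measure_support: "AE x in \<nu>. x \<in> measure_support \<nu>"
proof -
  define F where "F = {U. open U \<and> emeasure \<nu> U = 0}"
  obtain F' where F': "F' \<subseteq> F" "countable F'" "\<Union>F' = \<Union>F"
    using Lindelof[of F] unfolding F_def by blast
  have "(\<Union>U\<in>F'. U) \<in> null_sets \<nu>"
    using F' by (intro null_sets_UN') (auto simp: F_def null_sets_def)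
  moreover have "{x \<in> space \<nu>. x \<notin> measure_support \<nu>} \<subseteq> (\<Union>U\<in>F'. U)"
    using F'(3) unfolding F_def measure_support_def by (auto simp: not_less)
  ultimately show ?thesis by (rule AE_I')
qed

text \<open>On \<open>[0, b]\<close> the weight is at most \<open>b\<^sup>2 * exp b\<close>. After
  division by \<open>\<phi> \<theta>\<close>, which is at least \<open>1\<close>, the bound no
  longer depends on the tilt.\<close>

lemma tilted_moment_bound_bounded_support:
  assumes b: "AE x in \<nu>. x \<le> b" "0 \<le> b" and \<theta>: "0 \<le> \<theta>" "integrable \<nu> (\<lambda>x. exp (\<theta> * x))"
  shows "integrable \<nu> (\<lambda>x. tilted_square 1 x * exp (\<theta> * x))"
    and "expectation (\<lambda>x. tilted_square 1 x * exp (\<theta> * x)) \<le> 1 + b\<^sup>2 * exp b * \<phi> \<theta>"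
proof -
  have le: "tilted_square 1 x * exp (\<theta> * x) \<le> x\<^sup>2 + b\<^sup>2 * exp b * exp (\<theta> * x)" if "x \<le> b" for x
  proof (cases "x \<ge> 0")
    case True
    then have "tilted_square 1 x * exp (\<theta> * x) \<le> b\<^sup>2 * exp b * exp (\<theta> * x)"
      unfolding tilted_square_def using that by (intro mult_mono power_mono) auto
    then show ?thesis using zero_le_power2[of x] by linarith
  next
    case False
    then have "exp (\<theta> * x) \<le> 1" using \<theta> by (simp add: mult_nonneg_nonpos)
    then have "tilted_square 1 x * exp (\<theta> * x) \<le> x\<^sup>2 * 1"
      unfolding tilted_square_def using False by (intro mult_mono) auto
    moreover have "0 \<le> b\<^sup>2 * exp b * exp (\<theta> * x)" by simp
    ultimately show ?thesis by linarith
  qed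
  have int': "integrable \<nu> (\<lambda>x. x\<^sup>2 + b\<^sup>2 * exp b * exp (\<theta> * x))" using \<theta> integrable_square by simp
  show int: "integrable \<nu> (\<lambda>x. tilted_square 1 x * exp (\<theta> * x))"
  proof (rule Bochner_Integration.integrable_bound[OF int'])
    show "AE x in \<nu>. norm (tilted_square 1 x * exp (\<theta> * x)) \<le> norm (x\<^sup>2 + b\<^sup>2 * exp b * exp (\<theta> * x))"
      using b(1) by eventually_elim (use le in \<open>auto simp: tilted_square_nonneg\<close>)
  qed measurable
  have "expectation (\<lambda>x. tilted_square 1 x * exp (\<theta> * x)) \<le> expectation (\<lambda>x. x\<^sup>2 + b\<^sup>2 * exp b * exp (\<theta> * x))"
    by (rule integral_mono_AE[OF int int']) (use b(1) le in auto)
  also have "\<dots> = 1 + b\<^sup>2 * exp b * \<phi> \<theta>" using \<theta> integrable_square second_moment by simp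
  finally show "expectation (\<lambda>x. tilted_square 1 x * exp (\<theta> * x)) \<le> 1 + b\<^sup>2 * exp b * \<phi> \<theta>" .
qed

text \<open>After division by \<open>\<phi> \<theta>\<close> this is one moment bound for all tilted
  laws in use. The disjunction in the range of \<open>\<theta>\<close> joins the two cases: every
  admissible tilt for bounded support, those up to \<open>\<theta>bar\<close> otherwise.\<close>

lemma uniform_tilted_moment_bound:
  assumes cases: "bdd_above (measure_support \<nu>) \<or> ereal \<theta>bar < theta_star \<nu>"
  shows "\<exists>d C. 0 < d \<and>
    (\<forall>\<theta>. 0 \<le> \<theta> \<longrightarrow> ereal \<theta> < theta_star \<nu> \<longrightarrow> bdd_above (measure_support \<nu>) \<or> \<theta> \<le> \<theta>bar \<longrightarrow>
       integrable \<nu> (\<lambda>x. tilted_square d x * exp (\<theta> * x)) \<and>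
       expectation (\<lambda>x. tilted_square d x * exp (\<theta> * x)) \<le> C * \<phi> \<theta>)"
proof (cases "bdd_above (measure_support \<nu>)")
  case True
  then obtain b0 where b0: "\<And>x. x \<in> measure_support \<nu> \<Longrightarrow> x \<le> b0" unfolding bdd_above_def by auto
  define b where "b = max b0 0"
  have b: "AE x in \<nu>. x \<le> b" "0 \<le> b"
    using AE_in_measure_support unfolding b_def by (auto elim!: eventually_mono dest: b0)
  show ?thesis
  proof (rule exI[of _ 1], rule exI[of _ "1 + b\<^sup>2 * exp b"], intro conjI[OF zero_less_one] allI impI)
    fix \<theta> assume \<theta>: "0 \<le> \<theta>" "ereal \<theta> < theta_star \<nu>"
    have int: "integrable \<nu> (\<lambda>x. exp (\<theta> * x))" using integrable_exp_below_theta_star[OF \<theta>] by blast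
    show "integrable \<nu> (\<lambda>x. tilted_square 1 x * exp (\<theta> * x)) \<and>
       expectation (\<lambda>x. tilted_square 1 x * exp (\<theta> * x)) \<le> (1 + b\<^sup>2 * exp b) * \<phi> \<theta>"
      using tilted_moment_bound_bounded_support[OF b \<theta>(1) int] phi_ge_1[OF int] by (simp add: algebra_simps)
  qed
next
  case False
  show ?thesis
  proof (cases "0 \<le> \<theta>bar")
    case False
    show ?thesis
      by (rule exI[of _ 1]) (use \<open>\<not> bdd_above _\<close> False in auto)
  next
    case True
    have "ereal \<theta>bar < theta_star \<nu>" using cases False by simp
    then obtain u where u: "\<theta>bar < u" "integrable \<nu> (\<lambda>x. exp (u * x))"
      using integrable_exp_below_theta_star[OF True] by metis
    \<comment> \<open>Half of the room above \<open>\<theta>bar\<close> goes to the weight; the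
      other half is left to absorb the square.\<close>
    define d where "d = (u - \<theta>bar) / 2"
    have d: "0 < d" "d + \<theta>bar < u" using u by (auto simp: d_def field_simps)
    define C where "C = 1 + 2 / (u - d - \<theta>bar)\<^sup>2 * \<phi> u"
    have "C \<ge> 0" unfolding C_def using phi_ge_1[OF u(2)] by simp
    show ?thesis
    proof (rule exI[of _ d], rule exI[of _ C], intro conjI[OF d(1)] allI impI)
      fix \<theta> assume \<theta>: "0 \<le> \<theta>" "ereal \<theta> < theta_star \<nu>" "bdd_above (measure_support \<nu>) \<or> \<theta> \<le> \<theta>bar"
      have int: "integrable \<nu> (\<lambda>x. exp (\<theta> * x))" using integrable_exp_below_theta_star[OF \<theta>(1,2)] by blast
      have "C * 1 \<le> C * \<phi> \<theta>" by (intro mult_left_mono phi_ge_1 int \<open>C \<ge> 0\<close>)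
      then show "integrable \<nu> (\<lambda>x. tilted_square d x * exp (\<theta> * x)) \<and>
         expectation (\<lambda>x. tilted_square d x * exp (\<theta> * x)) \<le> C * \<phi> \<theta>"
        using tilted_moment_bound[OF u(2) less_imp_le[OF d(1)] \<theta>(1) _ d(2)] \<theta> False
        by (auto simp: C_def)
    qed
  qed
qed

section \<open>Small tilts: expansion of the moment generating function and of the tilted
  mean\<close>

lemma tendsto_expectation_tilted_square:
  assumes d: "0 < d" "integrable \<nu> (tilted_square d)"
  shows "((\<lambda>t. expectation (tilted_square t)) \<longlongrightarrow> 1) (at_right 0)"
proof (rule tendsto_at_right_sequentially[OF d(1)])
  fix S :: "nat \<Rightarrow> real" assume S: "\<And>n. 0 < S n" "\<And>n. S n < d" "S \<longlonglongrightarrow> 0"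
  have "(\<lambda>n. expectation (tilted_square (S n))) \<longlonglongrightarrow> expectation (\<lambda>x. x\<^sup>2)"
  proof (rule integral_dominated_convergence[where w = "tilted_square d"])
    show "AE x in \<nu>. (\<lambda>n. tilted_square (S n) x) \<longlonglongrightarrow> x\<^sup>2"
    proof (rule AE_I2)
      fix x
      have "(\<lambda>n. x\<^sup>2 * exp (S n * max x 0)) \<longlonglongrightarrow> x\<^sup>2 * exp (0 * max x 0)"
        by (intro tendsto_intros S)
      then show "(\<lambda>n. tilted_square (S n) x) \<longlonglongrightarrow> x\<^sup>2" by (simp add: tilted_square_def)
    qed
    show "AE x in \<nu>. norm (tilted_square (S n) x) \<le> tilted_square d x" for n
      using S(2)[of n] by (auto simp: tilted_square_nonneg intro!: tilted_square_mono)
  qed (use d in auto)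
  then show "(\<lambda>n. expectation (tilted_square (S n))) \<longlonglongrightarrow> 1" by (simp add: second_moment)
qed

lemma phi_le:
  assumes t: "0 \<le> t" and int: "integrable \<nu> (\<lambda>x. exp (t * x))" "integrable \<nu> (tilted_square t)"
  shows "\<phi> t \<le> 1 + t\<^sup>2 / 2 * expectation (tilted_square t)"
proof -
  have "\<phi> t \<le> expectation (\<lambda>x. 1 + t * x + t\<^sup>2 / 2 * tilted_square t x)"
    by (rule integral_mono[OF int(1) _ exp_le_tilted_square]) (use t integrable_id int in auto)
  also have "\<dots> = 1 + t\<^sup>2 / 2 * expectation (tilted_square t)"
    using integrable_id int mean_zero by simp
  finally show ?thesis .
qed

lemma integrable_tilted_square_mono:
  assumes "integrable \<nu> (tilted_square d)" "t \<le> d" shows "integrable \<nu> (tilted_square t)"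
  by (rule Bochner_Integration.integrable_bound[OF assms(1)])
     (use assms in \<open>auto simp: tilted_square_nonneg tilted_square_mono\<close>)

lemma integrable_exp_of_tilted_square:
  assumes d: "0 < d" "integrable \<nu> (tilted_square d)" and t: "0 \<le> t" "t \<le> d"
  shows "integrable \<nu> (\<lambda>x. exp (t * x))"
proof (rule Bochner_Integration.integrable_bound[where f = "\<lambda>x. 1 + t * x + t\<^sup>2 / 2 * tilted_square d x"])
  have "norm (exp (t * x)) \<le> norm (1 + t * x + t\<^sup>2 / 2 * tilted_square d x)" for x
    using exp_le_tilted_square[OF t, of x] by simp
  then show "AE x in \<nu>. norm (exp (t * x)) \<le> norm (1 + t * x + t\<^sup>2 / 2 * tilted_square d x)" by simp
  show "integrable \<nu> (\<lambda>x. 1 + t * x + t\<^sup>2 / 2 * tilted_square d x)"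
    by (intro Bochner_Integration.integrable_add integrable_mult_right integrable_const integrable_id d(2))
qed measurable

text \<open>The remainder in \<open>phi_le\<close> carries the weight at the shrinking parameter,
  whose expectation tends to the second moment \<open>1\<close>; this gives the sharp constant
  \<open>1 / 2\<close>.\<close>

lemma eventually_phi_le:
  assumes d: "0 < d" "integrable \<nu> (tilted_square d)" and e: "0 < e"
  shows "eventually (\<lambda>t. \<phi> t - 1 \<le> (1 / 2 + e) * t\<^sup>2) (at_right 0)"
proof -
  have "eventually (\<lambda>t. expectation (tilted_square t) < 1 + 2 * e) (at_right 0)"
    using tendsto_expectation_tilted_square[OF d] e by (intro order_tendstoD(2)[where y = 1]) auto
  moreover have "eventually (\<lambda>t. 0 < t \<and> t < d) (at_right 0)"
    using d(1) by (auto simp: eventually_at_right)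
  ultimately show ?thesis
  proof eventually_elim
    case (elim t)
    have "\<phi> t \<le> 1 + t\<^sup>2 / 2 * expectation (tilted_square t)"
      using integrable_exp_of_tilted_square[OF d, of t] integrable_tilted_square_mono[OF d(2), of t] elim
      by (intro phi_le) auto
    also have "\<dots> \<le> 1 + t\<^sup>2 / 2 * (1 + 2 * e)"
      using elim by (intro add_left_mono mult_left_mono) auto
    also have "\<dots> = 1 + (1 / 2 + e) * t\<^sup>2" by (simp add: field_simps)
    finally show ?case by simp
  qed
qed

lemma tendsto_phi:
  assumes d: "0 < d" "integrable \<nu> (tilted_square d)"
  shows "(\<phi> \<longlongrightarrow> 1) (at_right 0)"
proof (rule tendsto_sandwich[OF _ _ tendsto_const])
  have ev: "eventually (\<lambda>t. 0 < t \<and> t < d) (at_right 0)"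
    using d(1) by (auto simp: eventually_at_right)
  show "\<forall>\<^sub>F t in at_right 0. 1 \<le> \<phi> t"
    using ev by eventually_elim (simp add: phi_ge_1 integrable_exp_of_tilted_square[OF d])
  show "\<forall>\<^sub>F t in at_right 0. \<phi> t \<le> 1 + (1 / 2 + 1) * t\<^sup>2"
    using eventually_phi_le[OF d zero_less_one] by eventually_elim simp
  show "((\<lambda>t. 1 + (1 / 2 + 1) * t\<^sup>2) \<longlongrightarrow> (1::real)) (at_right 0)"
    by (auto intro!: tendsto_eq_intros)
qed

text \<open>As the mean vanishes, this is the unnormalised tilted mean divided by \<open>t\<close>,
  and its limit is the second moment. Dominated convergence applies with the majorant
  \<open>tilted_square d\<close>.\<close>

lemma tendsto_tilted_mean_quotient:
  assumes d: "0 < d" "integrable \<nu> (tilted_square d)"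
  shows "((\<lambda>t. expectation (\<lambda>x. x * ((exp (t * x) - 1) / t))) \<longlongrightarrow> 1) (at_right 0)"
proof (rule tendsto_at_right_sequentially[OF d(1)])
  fix S :: "nat \<Rightarrow> real" assume S: "\<And>n. 0 < S n" "\<And>n. S n < d" "S \<longlonglongrightarrow> 0"
  have "(\<lambda>n. expectation (\<lambda>x. x * ((exp (S n * x) - 1) / S n))) \<longlonglongrightarrow> expectation (\<lambda>x. x\<^sup>2)"
  proof (rule integral_dominated_convergence[where w = "tilted_square d"])
    show "AE x in \<nu>. (\<lambda>n. x * ((exp (S n * x) - 1) / S n)) \<longlonglongrightarrow> x\<^sup>2"
    proof (rule AE_I2)
      fix x :: real
      have "((\<lambda>t. exp (t * x)) has_real_derivative x) (at 0)"
        by (auto intro!: derivative_eq_intros)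
      then have "((\<lambda>t. (exp (t * x) - 1) / t) \<longlongrightarrow> x) (at 0)"
        by (simp add: DERIV_def)
      moreover have "filterlim S (at 0) sequentially"
        using S by (auto simp: filterlim_at eventually_sequentially less_imp_neq[symmetric])
      ultimately have "(\<lambda>n. (exp (S n * x) - 1) / S n) \<longlonglongrightarrow> x"
        by (rule filterlim_compose)
      then have "(\<lambda>n. x * ((exp (S n * x) - 1) / S n)) \<longlonglongrightarrow> x * x"
        by (intro tendsto_intros)
      then show "(\<lambda>n. x * ((exp (S n * x) - 1) / S n)) \<longlonglongrightarrow> x\<^sup>2" by (simp add: power2_eq_square)
    qed
    show "AE x in \<nu>. norm (x * ((exp (S n * x) - 1) / S n)) \<le> tilted_square d x" for n
    proof (rule AE_I2)
      fix x
      have "\<bar>exp (S n * x) - 1\<bar> / S n \<le> \<bar>S n * x\<bar> * exp (max (S n * x) 0) / S n"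
        using S(1)[of n] by (intro divide_right_mono exp_minus_one_le) auto
      also have "\<dots> = \<bar>x\<bar> * exp (S n * max x 0)"
        using S(1)[of n] by (simp add: abs_mult max_mult_zero)
      finally have "\<bar>x\<bar> * (\<bar>exp (S n * x) - 1\<bar> / S n) \<le> \<bar>x\<bar> * (\<bar>x\<bar> * exp (S n * max x 0))"
        by (rule mult_left_mono) simp
      also have "\<dots> = tilted_square (S n) x"
        by (simp add: tilted_square_def power2_eq_square flip: mult.assoc)
      also have "\<dots> \<le> tilted_square d x" using S(2)[of n] by (intro tilted_square_mono) simp
      finally show "norm (x * ((exp (S n * x) - 1) / S n)) \<le> tilted_square d x"
        using S(1)[of n] by (simp add: abs_mult)
    qed
  qed (use d in auto)
  then show "(\<lambda>n. expectation (\<lambda>x. x * ((exp (S n * x) - 1) / S n))) \<longlonglongrightarrow> 1" by (simp add: second_moment)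
qed

lemma integrable_mult_exp:
  assumes "integrable \<nu> (\<lambda>x. exp (\<theta> * x))" "integrable \<nu> (\<lambda>x. tilted_square d x * exp (\<theta> * x))" "0 \<le> d"
  shows "integrable \<nu> (\<lambda>x. x * exp (\<theta> * x))"
proof (rule Bochner_Integration.integrable_bound[OF Bochner_Integration.integrable_add[OF assms(1,2)]])
  have "\<bar>x\<bar> * exp (\<theta> * x) \<le> exp (\<theta> * x) + tilted_square d x * exp (\<theta> * x)" for x
  proof -
    have "\<bar>x\<bar> \<le> 1 + x\<^sup>2"
      using sum_squares_bound[of 1 "\<bar>x\<bar>"] zero_le_power2[of x] unfolding power2_abs by simp
    also have "\<dots> \<le> 1 + tilted_square d x" using square_le_tilted_square[OF assms(3)] by simp
    finally have "\<bar>x\<bar> * exp (\<theta> * x) \<le> (1 + tilted_square d x) * exp (\<theta> * x)" by (rule mult_right_mono) simp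
    then show ?thesis by (simp add: distrib_right)
  qed
  then show "AE x in \<nu>. norm (x * exp (\<theta> * x)) \<le> norm (exp (\<theta> * x) + tilted_square d x * exp (\<theta> * x))"
    by (auto simp: abs_mult intro: order.trans[OF _ abs_ge_self])
qed measurable

text \<open>The normalised tilted mean is asymptotic to \<open>t\<close>, being \<open>t\<close>
  times a quotient of two quantities that tend to \<open>1\<close>; the factor \<open>r < 1\<close>
  leaves room.\<close>

lemma eventually_tilted_mean_ge:
  assumes d: "0 < d" "integrable \<nu> (tilted_square d)" and r: "r < 1"
  shows "eventually (\<lambda>t. integrable \<nu> (\<lambda>x. x * exp (t * x)) \<and> r * t * \<phi> t \<le> expectation (\<lambda>x. x * exp (t * x))) (at_right 0)"
proof -
  let ?q = "\<lambda>t. expectation (\<lambda>x. x * ((exp (t * x) - 1) / t))"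
  have "((\<lambda>t. ?q t / \<phi> t) \<longlongrightarrow> 1 / 1) (at_right 0)"
    by (intro tendsto_divide tendsto_tilted_mean_quotient[OF d] tendsto_phi[OF d]) simp
  then have "eventually (\<lambda>t. r < ?q t / \<phi> t) (at_right 0)"
    using r by (intro order_tendstoD(1)[where y = 1]) auto
  moreover have "eventually (\<lambda>t. 0 < t \<and> t < d / 2) (at_right 0)"
    using d(1) by (auto simp: eventually_at_right intro!: exI[of _ "d / 2"])
  ultimately show ?thesis
  proof eventually_elim
    case (elim t)
    have int: "integrable \<nu> (\<lambda>x. exp (t * x))"
      by (rule integrable_exp_of_tilted_square[OF d]) (use elim in auto)
    \<comment> \<open>At parameter \<open>0\<close> the weight is the plain square; in this form it
      feeds \<open>integrable_mult_exp\<close>.\<close>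
    have "integrable \<nu> (\<lambda>x. tilted_square 0 x * exp (t * x))"
    proof (rule Bochner_Integration.integrable_bound[OF d(2)])
      have "tilted_square 0 x * exp (t * x) \<le> tilted_square d x" for x
      proof -
        have "t * x \<le> t * max x 0" using elim by (intro mult_left_mono) auto
        also have "\<dots> \<le> d * max x 0" using elim by (intro mult_right_mono) auto
        finally show ?thesis unfolding tilted_square_def by (simp add: mult_left_mono)
      qed
      then show "AE x in \<nu>. norm (tilted_square 0 x * exp (t * x)) \<le> norm (tilted_square d x)"
        by (auto simp: tilted_square_nonneg)
    qed measurable
    then have int2: "integrable \<nu> (\<lambda>x. x * exp (t * x))"
      by (rule integrable_mult_exp[OF int]) simp
    have "?q t = expectation (\<lambda>x. x * exp (t * x) / t - x / t)"
      by (simp add: right_diff_distrib diff_divide_distrib)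
    also have "\<dots> = expectation (\<lambda>x. x * exp (t * x)) / t"
      using int2 integrable_id mean_zero by simp
    finally have "?q t = expectation (\<lambda>x. x * exp (t * x)) / t" .
    moreover have "r * \<phi> t < ?q t"
      using elim(1) phi_ge_1[OF int] by (subst (asm) pos_less_divide_eq) auto
    ultimately have "r * \<phi> t * t < expectation (\<lambda>x. x * exp (t * x))"
      using elim(2) by (simp add: pos_less_divide_eq)
    then show ?case using int2 by (simp add: mult_ac)
  qed
qed

text \<open>The function \<open>y \<mapsto> y * (exp (s * y) - 1)\<close> is nonnegative for \<open>s \<ge> 0\<close>; applied with
  \<open>y = x - a\<close> this gives monotonicity of the tilted mean without differentiating \<open>ln \<phi>\<close>.\<close>

lemma tilted_mean_mono:
  assumes t: "t \<le> \<theta>"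
    and int: "integrable \<nu> (\<lambda>x. exp (t * x))" "integrable \<nu> (\<lambda>x. x * exp (t * x))"
      "integrable \<nu> (\<lambda>x. exp (\<theta> * x))" "integrable \<nu> (\<lambda>x. x * exp (\<theta> * x))"
    and a: "a * \<phi> t \<le> expectation (\<lambda>x. x * exp (t * x))"
  shows "a * \<phi> \<theta> \<le> expectation (\<lambda>x. x * exp (\<theta> * x))"
proof -
  have pt: "exp ((\<theta> - t) * a) * (x * exp (t * x) - a * exp (t * x)) \<le> x * exp (\<theta> * x) - a * exp (\<theta> * x)" for x
  proof -
    have "0 \<le> (x - a) * (exp ((\<theta> - t) * (x - a)) - 1)"
      using t by (cases "x \<ge> a") (auto simp: zero_le_mult_iff mult_nonneg_nonpos)
    then have "0 \<le> exp ((\<theta> - t) * a) * exp (t * x) * ((x - a) * (exp ((\<theta> - t) * (x - a)) - 1))"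
      by simp
    also have "\<dots> = (x - a) * (exp ((\<theta> - t) * a + t * x + (\<theta> - t) * (x - a))) - (x - a) * exp ((\<theta> - t) * a) * exp (t * x)"
      by (simp only: exp_add) (simp add: algebra_simps)
    also have "(\<theta> - t) * a + t * x + (\<theta> - t) * (x - a) = \<theta> * x" by (simp add: algebra_simps)
    finally show ?thesis by (simp add: algebra_simps)
  qed
  have "0 \<le> exp ((\<theta> - t) * a) * (expectation (\<lambda>x. x * exp (t * x)) - a * \<phi> t)" using a by simp
  also have "\<dots> = expectation (\<lambda>x. exp ((\<theta> - t) * a) * (x * exp (t * x) - a * exp (t * x)))"
    using int by simp
  also have "\<dots> \<le> expectation (\<lambda>x. x * exp (\<theta> * x) - a * exp (\<theta> * x))"
    by (rule integral_mono[OF _ _ pt]) (use int in auto)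
  also have "\<dots> = expectation (\<lambda>x. x * exp (\<theta> * x)) - a * \<phi> \<theta>" using int by simp
  finally show ?thesis by simp
qed

text \<open>Carries integrals over the sample space back to \<open>\<nu>\<close>; with a finite
  normaliser the density is \<open>exp (\<theta> * x) / \<phi> \<theta>\<close>.\<close>

lemma distributed_tilt:
  assumes dist: "distributed P \<nu> X (\<lambda>x. ennreal (tilt_density \<nu> \<theta> x))"
    and int: "integrable \<nu> (\<lambda>x. exp (\<theta> * x))" and g: "g \<in> borel_measurable borel"
  shows "integrable P (\<lambda>\<omega>. g (X \<omega>)) \<longleftrightarrow> integrable \<nu> (\<lambda>x. g x * exp (\<theta> * x))"
    and "(\<integral>\<omega>. g (X \<omega>) \<partial>P) = expectation (\<lambda>x. g x * exp (\<theta> * x)) / \<phi> \<theta>"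
proof -
  have g': "g \<in> borel_measurable \<nu>" using g by simp
  have pos: "0 \<le> tilt_density \<nu> \<theta> x" for x by (simp add: tilt_density_def)
  have eq: "(\<lambda>x. tilt_density \<nu> \<theta> x * g x) = (\<lambda>x. (g x * exp (\<theta> * x)) / \<phi> \<theta>)"
    by (simp add: tilt_density_eq[OF int] mult.commute)
  show "integrable P (\<lambda>\<omega>. g (X \<omega>)) \<longleftrightarrow> integrable \<nu> (\<lambda>x. g x * exp (\<theta> * x))"
    using distributed_integrable[OF dist g' pos] phi_ge_1[OF int] unfolding eq divide_inverse
    by auto
  show "(\<integral>\<omega>. g (X \<omega>) \<partial>P) = expectation (\<lambda>x. g x * exp (\<theta> * x)) / \<phi> \<theta>"
    using distributed_integral[OF dist g' pos] unfolding eq by simp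
qed

end

section \<open>Rates along the sequence\<close>

text \<open>A single term of the exponential series gives \<open>m ^ m \<le> fact m * exp m\<close>,
  and this is combined with \<open>(M choose m) * fact m \<le> M ^ m\<close>.\<close>

lemma binomial_le_exp:
  assumes "0 < m" "m \<le> M"
  shows "real (M choose m) \<le> exp (real m * ln (real M / real m) + real m)"
proof -
  have "(\<Sum>k\<in>{m}. inverse (fact k) *\<^sub>R real m ^ k) \<le> (\<Sum>k. inverse (fact k) *\<^sub>R real m ^ k)"
    by (rule sum_le_suminf[OF summable_exp_generic]) auto
  then have fact: "real m ^ m \<le> fact m * exp (real m)"
    by (simp add: exp_def field_simps)
  have "real ((M choose m) * fact m) \<le> real (M ^ m)"
    by (intro of_nat_mono binomial_fact_pow)
  then have "real (M choose m) * fact m \<le> real M ^ m" by simp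
  then have "real (M choose m) * fact m * real m ^ m \<le> real M ^ m * (fact m * exp (real m))"
    using fact by (intro mult_mono) auto
  then have "real (M choose m) \<le> (real M / real m) ^ m * exp (real m)"
    using assms by (simp add: power_divide field_simps)
  also have "\<dots> = exp (real m * ln (real M / real m) + real m)"
    using assms by (simp add: exp_add exp_of_nat_mult)
  finally show ?thesis .
qed

locale submatrix_scaling =
  fixes M N m n :: "nat \<Rightarrow> nat"
  assumes m_pos: "\<And>k. 0 < m k" and m_le: "\<And>k. m k \<le> M k"
    and n_pos: "\<And>k. 0 < n k" and n_le: "\<And>k. n k \<le> N k"
    and m_inf: "filterlim m at_top sequentially" and n_inf: "filterlim n at_top sequentially"
    and mM: "(\<lambda>k. real (m k) / real (M k)) \<longlonglongrightarrow> 0" and nN: "(\<lambda>k. real (n k) / real (N k)) \<longlonglongrightarrow> 0"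
    and log3: "(\<lambda>k. (ln (real (max (M k) (N k)))) ^ 3 / real (min (m k) (n k))) \<longlonglongrightarrow> 0"
begin

text \<open>The leading term of the logarithm of the number of blocks; the bound used for the
  remainder is \<open>m + n\<close>.\<close>

definition log_count :: "nat \<Rightarrow> real" where
  "log_count k = real (m k) * ln (real (M k) / real (m k)) + real (n k) * ln (real (N k) / real (n k))"

text \<open>The critical signal strength, which also serves as the exponential parameter
  \<open>t\<close>. It is calibrated so that \<open>m * n * \<tau>\<^sup>2 / 2\<close> equals
  \<open>log_count\<close>.\<close>

definition \<tau> :: "nat \<Rightarrow> real" where
  "\<tau> k = sqrt (2 * log_count k / (real (m k) * real (n k)))"

definition L :: "nat \<Rightarrow> real" where
  "L k = ln (real (max (M k) (N k)))"

lemma ratio_inf: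
  "filterlim (\<lambda>k. ln (real (M k) / real (m k))) at_top sequentially"
  "filterlim (\<lambda>k. ln (real (N k) / real (n k))) at_top sequentially"
proof -
  have "filterlim (\<lambda>k. inverse (real (m k) / real (M k))) at_top sequentially"
    using mM by (rule filterlim_inverse_at_top) (use m_pos m_le in \<open>auto intro!: always_eventually simp: zero_less_divide_iff intro: less_le_trans\<close>)
  then show "filterlim (\<lambda>k. ln (real (M k) / real (m k))) at_top sequentially"
    by (intro filterlim_compose[OF ln_at_top]) simp
  have "filterlim (\<lambda>k. inverse (real (n k) / real (N k))) at_top sequentially"
    using nN by (rule filterlim_inverse_at_top) (use n_pos n_le in \<open>auto intro!: always_eventually simp: zero_less_divide_iff intro: less_le_trans\<close>)
  then show "filterlim (\<lambda>k. ln (real (N k) / real (n k))) at_top sequentially"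
    by (intro filterlim_compose[OF ln_at_top]) simp
qed

lemma ln_ratio_nonneg: "0 \<le> ln (real (M k) / real (m k))" "0 \<le> ln (real (N k) / real (n k))"
  using m_pos[of k] m_le[of k] n_pos[of k] n_le[of k] by auto

lemma log_count_nonneg: "0 \<le> log_count k"
  unfolding log_count_def using ln_ratio_nonneg[of k] by simp

lemma tau_square: "(\<tau> k)\<^sup>2 = 2 * log_count k / (real (m k) * real (n k))"
  unfolding \<tau>_def using log_count_nonneg[of k] by simp

lemma mn_tau_square: "real (m k) * real (n k) * (\<tau> k)\<^sup>2 = 2 * log_count k"
  using m_pos[of k] n_pos[of k] by (simp add: tau_square)

text \<open>Both logarithms diverge, so the \<open>m + n\<close> lost in bounding the binomial
  coefficients is of smaller order.\<close>

lemma eventually_sizes_le_log_count: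
  assumes "0 < e" shows "eventually (\<lambda>k. real (m k) + real (n k) \<le> e * log_count k) sequentially"
proof -
  have "eventually (\<lambda>k. 1 / e \<le> ln (real (M k) / real (m k))) sequentially"
    "eventually (\<lambda>k. 1 / e \<le> ln (real (N k) / real (n k))) sequentially"
    using ratio_inf by (auto simp: filterlim_at_top)
  then show ?thesis
  proof eventually_elim
    case (elim k)
    have "real (m k) * (1 / e) + real (n k) * (1 / e) \<le> log_count k"
      unfolding log_count_def using elim by (intro add_mono mult_left_mono) auto
    then show ?case using assms by (simp add: field_simps)
  qed
qed

lemma log_count_inf: "filterlim log_count at_top sequentially"
proof (rule filterlim_at_top_mono)
  show "filterlim (\<lambda>k. real (m k)) at_top sequentially"
    by (rule filterlim_compose[OF filterlim_real_sequentially m_inf])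
  show "eventually (\<lambda>k. real (m k) \<le> log_count k) sequentially"
    using eventually_sizes_le_log_count[OF zero_less_one] by eventually_elim simp
qed

lemma eventually_tau_pos: "eventually (\<lambda>k. 0 < \<tau> k) sequentially"
proof -
  have "eventually (\<lambda>k. 1 \<le> log_count k) sequentially"
    using log_count_inf by (auto simp: filterlim_at_top)
  then show ?thesis
    by eventually_elim (use m_pos n_pos in \<open>simp add: \<tau>_def\<close>)
qed

lemma M_pos: "0 < M k" and N_pos: "0 < N k"
  using m_pos[of k] m_le[of k] n_pos[of k] n_le[of k] by auto

lemma ln_le_L: "ln (real (M k)) \<le> L k" "ln (real (N k)) \<le> L k"
  unfolding L_def using M_pos[of k] N_pos[of k] by auto

text \<open>Each summand of \<open>log_count\<close> is at most \<open>max m n\<close> times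
  \<open>L\<close>, and \<open>m * n\<close> is the product of the maximum and the minimum.\<close>

lemma tau_square_le: "(\<tau> k)\<^sup>2 * real (min (m k) (n k)) \<le> 4 * L k"
proof -
  have l: "ln (real (M k) / real (m k)) \<le> L k" "ln (real (N k) / real (n k)) \<le> L k"
    using ln_le_L[of k] m_pos[of k] n_pos[of k] M_pos[of k] N_pos[of k]
    by (auto simp: ln_div intro: order.trans[rotated])
  have L0: "0 \<le> L k" using l ln_ratio_nonneg[of k] by linarith
  have "log_count k \<le> real (max (m k) (n k)) * L k + real (max (m k) (n k)) * L k"
    unfolding log_count_def using l ln_ratio_nonneg[of k] by (intro add_mono mult_mono) auto
  then have "2 * log_count k \<le> 4 * (real (max (m k) (n k)) * L k)" by simp
  moreover have mm: "real (m k) * real (n k) = real (max (m k) (n k)) * real (min (m k) (n k))"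
    by (auto simp: max_def min_def)
  ultimately have "real (max (m k) (n k)) * ((\<tau> k)\<^sup>2 * real (min (m k) (n k))) \<le> real (max (m k) (n k)) * (4 * L k)"
    using mn_tau_square[of k] by (simp add: mult_ac)
  then show ?thesis using m_pos[of k] by (simp add: max_def split: if_splits)
qed

lemma L_inf: "filterlim L at_top sequentially"
proof (rule filterlim_at_top_mono)
  show "filterlim (\<lambda>k. ln (real (m k))) at_top sequentially"
    by (intro filterlim_compose[OF ln_at_top] filterlim_compose[OF filterlim_real_sequentially m_inf])
  have "ln (real (m k)) \<le> ln (real (M k))" for k using m_pos[of k] m_le[of k] by simp
  then show "eventually (\<lambda>k. ln (real (m k)) \<le> L k) sequentially"
    using order.trans[OF _ ln_le_L(1)] by (intro always_eventually allI) blast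
qed

text \<open>Multiplying \<open>tau_square_le\<close> by the square of \<open>L\<close> leaves
  \<open>4 * L ^ 3\<close> over the minimum of \<open>m\<close> and \<open>n\<close>, which the
  cubic logarithm condition sends to \<open>0\<close>.\<close>

lemma tau_L: "(\<lambda>k. \<tau> k * L k) \<longlonglongrightarrow> 0"
proof -
  have sq: "(\<lambda>k. (\<tau> k * L k)\<^sup>2) \<longlonglongrightarrow> 0"
  proof (rule tendsto_sandwich[OF _ _ tendsto_const])
    show "(\<lambda>k. 4 * (L k ^ 3 / real (min (m k) (n k)))) \<longlonglongrightarrow> 0"
      using tendsto_mult_right_zero[OF log3] unfolding L_def .
    have "(\<tau> k * L k)\<^sup>2 \<le> 4 * (L k ^ 3 / real (min (m k) (n k)))" for k
    proof -
      have pos: "real (min (m k) (n k)) > 0" using m_pos n_pos by (simp add: min_def)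
      have "(\<tau> k)\<^sup>2 * real (min (m k) (n k)) * (L k)\<^sup>2 \<le> 4 * L k * (L k)\<^sup>2"
        by (intro mult_right_mono tau_square_le) simp
      then have "(\<tau> k * L k)\<^sup>2 * real (min (m k) (n k)) \<le> 4 * L k ^ 3"
        by (simp add: power_mult_distrib power2_eq_square power3_eq_cube mult_ac)
      then show ?thesis using pos by (simp add: pos_le_divide_eq)
    qed
    then show "\<forall>\<^sub>F k in sequentially. (\<tau> k * L k)\<^sup>2 \<le> 4 * (L k ^ 3 / real (min (m k) (n k)))" by simp
  qed simp
  have "(\<lambda>k. sqrt ((\<tau> k * L k)\<^sup>2)) \<longlonglongrightarrow> sqrt 0" by (intro tendsto_intros sq)
  then show ?thesis by (simp add: tendsto_rabs_zero_iff)
qed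

lemma tau_nonneg: "0 \<le> \<tau> k"
  unfolding \<tau>_def using log_count_nonneg[of k] by simp

lemma tau_zero: "\<tau> \<longlonglongrightarrow> 0"
proof (rule tendsto_sandwich[OF _ _ tendsto_const tau_L])
  show "\<forall>\<^sub>F k in sequentially. 0 \<le> \<tau> k" by (simp add: tau_nonneg)
  have "eventually (\<lambda>k. 1 \<le> L k) sequentially" using L_inf by (auto simp: filterlim_at_top)
  then show "\<forall>\<^sub>F k in sequentially. \<tau> k \<le> \<tau> k * L k"
    by eventually_elim (use tau_nonneg mult_left_mono in fastforce)
qed

lemma tau_at_right: "0 < c \<Longrightarrow> filterlim (\<lambda>k. c * \<tau> k) (at_right 0) sequentially"
  using tendsto_mult_right_zero[OF tau_zero, of c] eventually_tau_pos
  by (auto simp: filterlim_at elim!: eventually_mono)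

section \<open>Decay of the four failure probabilities\<close>

lemma entries_tail: "0 < d \<Longrightarrow> (\<lambda>k. real (M k * N k) * (C * exp (- d / \<tau> k))) \<longlonglongrightarrow> 0"
proof -
  assume d: "0 < d"
  \<comment> \<open>This puts \<open>d / \<tau>\<close> above \<open>3 * L\<close>; as there are at
    most \<open>exp (2 * L)\<close> cells, a decay of \<open>exp (- L)\<close> remains.\<close>
  have "eventually (\<lambda>k. \<tau> k * L k < d / 3) sequentially"
    using tau_L d by (intro order_tendstoD) auto
  then have ev: "eventually (\<lambda>k. norm (real (M k * N k) * exp (- d / \<tau> k)) \<le> exp (- L k)) sequentially"
    using eventually_tau_pos
  proof eventually_elim
    case (elim k)
    have "3 * L k \<le> d / \<tau> k" using elim by (simp add: field_simps)
    moreover have "real (M k) * real (N k) = exp (ln (real (M k)) + ln (real (N k)))"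
      using M_pos[of k] N_pos[of k] by (simp add: exp_add)
    ultimately have "real (M k) * real (N k) * exp (- d / \<tau> k) = exp (ln (real (M k)) + ln (real (N k)) - d / \<tau> k)"
      by (simp add: exp_diff exp_minus field_simps)
    also have "\<dots> \<le> exp (- L k)" using ln_le_L[of k] \<open>3 * L k \<le> d / \<tau> k\<close> by simp
    finally show ?case by simp
  qed
  have "(\<lambda>k. exp (- L k)) \<longlonglongrightarrow> 0"
    by (intro filterlim_compose[OF exp_at_bot] filterlim_compose[OF filterlim_uminus_at_bot_at_top] L_inf)
  then have "(\<lambda>k. real (M k * N k) * exp (- d / \<tau> k)) \<longlonglongrightarrow> 0"
    by (rule Lim_null_comparison[OF ev])
  then show ?thesis using tendsto_mult_right_zero[of _ sequentially C] by (simp add: mult_ac)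
qed

lemma choose_le: "real (M k choose m k) \<le> exp (log_count k + real (m k) + real (n k))"
  "real (M k choose m k) * real (N k choose n k) \<le> exp (log_count k + real (m k) + real (n k))"
proof -
  note b = binomial_le_exp[OF m_pos[of k] m_le[of k]] binomial_le_exp[OF n_pos[of k] n_le[of k]]
  have "exp (real (m k) * ln (real (M k) / real (m k)) + real (m k)) \<le> exp (log_count k + real (m k) + real (n k))"
    unfolding log_count_def using ln_ratio_nonneg[of k] by simp
  then show "real (M k choose m k) \<le> exp (log_count k + real (m k) + real (n k))" using b(1) by linarith
  have "real (M k choose m k) * real (N k choose n k) \<le>
      exp (real (m k) * ln (real (M k) / real (m k)) + real (m k)) * exp (real (n k) * ln (real (N k) / real (n k)) + real (n k))"
    using b by (intro mult_mono) auto
  also have "\<dots> = exp (log_count k + real (m k) + real (n k))"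
    unfolding log_count_def by (simp add: exp_add mult_ac)
  finally show "real (M k choose m k) * real (N k choose n k) \<le> exp (log_count k + real (m k) + real (n k))" .
qed

lemma exp_minus_log_count: "0 < c \<Longrightarrow> (\<lambda>k. exp (- (c * log_count k))) \<longlonglongrightarrow> 0"
  by (intro filterlim_compose[OF exp_at_bot] filterlim_compose[OF filterlim_uminus_at_bot_at_top]
      filterlim_tendsto_pos_mult_at_top[OF tendsto_const _ log_count_inf])

lemma eventually_n_small: "0 < e \<Longrightarrow> eventually (\<lambda>k. real (n k) / real (N k) < e) sequentially"
  using nN by (intro order_tendstoD) auto

text \<open>\<open>m * N * \<tau>\<^sup>2\<close> is \<open>2 * log_count\<close> times
  \<open>N / n\<close>, and \<open>N / n\<close> diverges, so any constant \<open>c > 0\<close>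
  overcomes the number of row sets.\<close>

lemma blocks_tail:
  assumes c: "0 < c"
  shows "(\<lambda>k. real (M k choose m k) * exp (- c * (real (m k) * real (N k) * (\<tau> k)\<^sup>2))) \<longlonglongrightarrow> 0"
proof (rule Lim_null_comparison[OF _ exp_minus_log_count[OF zero_less_one]])
  have c': "0 < c / 2" using c by simp
  show "\<forall>\<^sub>F k in sequentially. norm (real (M k choose m k) * exp (- c * (real (m k) * real (N k) * (\<tau> k)\<^sup>2))) \<le> exp (- (1 * log_count k))"
    using eventually_n_small[OF c'] eventually_sizes_le_log_count[OF zero_less_one]
  proof eventually_elim
    case (elim k)
    \<comment> \<open>\<open>n / N < c / 2\<close> makes the exponent at least
      \<open>4 * log_count\<close>, of which the binomial bound uses up at most
      \<open>2 * log_count\<close>.\<close>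
    have "real (n k) * (2 / c) \<le> real (N k)" using elim(1) c N_pos[of k] by (simp add: field_simps)
    then have "real (m k) * (real (n k) * (2 / c)) * (\<tau> k)\<^sup>2 \<le> real (m k) * real (N k) * (\<tau> k)\<^sup>2"
      by (intro mult_right_mono mult_left_mono) auto
    moreover have "real (m k) * (real (n k) * (2 / c)) * (\<tau> k)\<^sup>2 = (2 / c) * (2 * log_count k)"
      using mn_tau_square[of k] by (simp add: mult_ac)
    ultimately have "4 * log_count k \<le> c * (real (m k) * real (N k) * (\<tau> k)\<^sup>2)"
      using c by (simp add: field_simps)
    then have "real (M k choose m k) * exp (- c * (real (m k) * real (N k) * (\<tau> k)\<^sup>2))
        \<le> exp (log_count k + real (m k) + real (n k)) * exp (- (4 * log_count k))"
      by (intro mult_mono choose_le) auto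
    also have "\<dots> = exp (real (m k) + real (n k) - 3 * log_count k)" by (simp flip: exp_add)
    also have "\<dots> \<le> exp (- (1 * log_count k))" using elim(2) log_count_nonneg[of k] by simp
    finally show ?case by simp
  qed
qed

text \<open>Eventually \<open>log_count \<ge> m\<close>, so
  \<open>n * \<tau>\<^sup>2 \<ge> 1\<close> and \<open>sqrt n \<le> n * \<tau>\<close>; the quotient
  is then at most a constant multiple of \<open>n / N\<close>.\<close>

lemma rows_tail:
  assumes "0 \<le> C" "0 < e"
  shows "(\<lambda>k. sqrt (C * real (n k)) / (e * real (N k) * \<tau> k)) \<longlonglongrightarrow> 0"
proof (rule Lim_null_comparison)
  show "(\<lambda>k. sqrt C / e * (real (n k) / real (N k))) \<longlonglongrightarrow> 0"
    by (rule tendsto_mult_right_zero[OF nN])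
  have "eventually (\<lambda>k. 1 \<le> ln (real (M k) / real (m k))) sequentially"
    using ratio_inf by (auto simp: filterlim_at_top)
  then show "\<forall>\<^sub>F k in sequentially. norm (sqrt (C * real (n k)) / (e * real (N k) * \<tau> k)) \<le> sqrt C / e * (real (n k) / real (N k))"
    using eventually_tau_pos
  proof eventually_elim
    case (elim k)
    have "real (m k) * 1 \<le> log_count k"
      unfolding log_count_def using elim ln_ratio_nonneg[of k]
      by (intro order.trans[OF mult_left_mono[OF elim(1)]]) auto
    then have "real (m k) * 1 \<le> real (m k) * (real (n k) * (\<tau> k)\<^sup>2)"
      using mn_tau_square[of k] log_count_nonneg[of k] by (simp add: mult.assoc)
    then have "1 \<le> real (n k) * (\<tau> k)\<^sup>2" using m_pos[of k] by simp
    then have "sqrt 1 \<le> sqrt (real (n k) * (\<tau> k)\<^sup>2)" by (rule real_sqrt_le_mono)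
    then have "1 \<le> sqrt (real (n k)) * \<tau> k" using tau_nonneg[of k] by (simp add: real_sqrt_mult)
    then have "sqrt (real (n k)) * 1 \<le> sqrt (real (n k)) * (sqrt (real (n k)) * \<tau> k)"
      by (intro mult_left_mono) auto
    then have "sqrt (real (n k)) \<le> real (n k) * \<tau> k" by (simp flip: mult.assoc)
    then have "sqrt C * sqrt (real (n k)) / (e * real (N k) * \<tau> k) \<le> sqrt C * (real (n k) * \<tau> k) / (e * real (N k) * \<tau> k)"
      using assms elim by (intro divide_right_mono mult_left_mono) auto
    also have "\<dots> = sqrt C / e * (real (n k) / real (N k))" using elim by simp
    finally show ?case using assms elim by (simp add: real_sqrt_mult)
  qed
qed

lemma chebyshev_tail:
  "(\<lambda>k. C / (e\<^sup>2 * (real (m k) * real (n k) * (\<tau> k)\<^sup>2))) \<longlonglongrightarrow> 0"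
proof -
  have "filterlim (\<lambda>k. 2 * log_count k) at_top sequentially"
    by (rule filterlim_tendsto_pos_mult_at_top[OF tendsto_const _ log_count_inf]) simp
  then have "(\<lambda>k. C / e\<^sup>2 * inverse (2 * log_count k)) \<longlonglongrightarrow> 0"
    by (intro tendsto_mult_right_zero tendsto_inverse_0_at_top)
  then show ?thesis unfolding mn_tau_square by (simp add: field_simps)
qed

end

section \<open>Power of the permutation scan test\<close>

theorem theorem2:
  fixes \<nu> :: "real measure"
    and M N m n :: "nat \<Rightarrow> nat"
    and \<theta>dd :: "nat \<Rightarrow> real"
    and Itrue Jtrue :: "nat \<Rightarrow> nat set"
    and \<theta> :: "nat \<Rightarrow> nat \<times> nat \<Rightarrow> real"
    and P :: "nat \<Rightarrow> 'a measure"
    and X :: "nat \<Rightarrow> nat \<times> nat \<Rightarrow> 'a \<Rightarrow> real"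
    and G :: "nat \<Rightarrow> nat \<Rightarrow> (nat \<times> nat \<Rightarrow> nat \<times> nat) set"
    and \<alpha> :: real
  assumes "real_distribution \<nu>"
    and "integrable \<nu> (\<lambda>x. x)" and "prob_space.expectation \<nu> (\<lambda>x. x) = 0"
    and "integrable \<nu> (\<lambda>x. x\<^sup>2)" and "prob_space.variance \<nu> (\<lambda>x. x) = 1"
    and "\<exists>t>0. mgf \<nu> t < \<infinity>"
    and "\<And>k. 0 < m k" and "\<And>k. m k \<le> M k"
    and "\<And>k. 0 < n k" and "\<And>k. n k \<le> N k"
    and "\<And>k. 0 < \<theta>dd k"
    and "\<And>k. Itrue k \<subseteq> {1..M k}" and "\<And>k. card (Itrue k) = m k"
    and "\<And>k. Jtrue k \<subseteq> {1..N k}" and "\<And>k. card (Jtrue k) = n k"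
    and "\<And>k ij. ij \<in> grid (M k) (N k) \<Longrightarrow> 0 \<le> \<theta> k ij \<and> ereal (\<theta> k ij) < theta_star \<nu>"
    and "\<And>k ij. ij \<in> Itrue k \<times> Jtrue k \<Longrightarrow> \<theta>dd k \<le> \<theta> k ij"
    and "\<And>k ij. ij \<in> grid (M k) (N k) - Itrue k \<times> Jtrue k \<Longrightarrow> \<theta> k ij = 0"
    and "\<And>k. prob_space (P k)"
    and "\<And>k. prob_space.indep_vars (P k) (\<lambda>_. borel) (X k) (grid (M k) (N k))"
    and "\<And>k ij. ij \<in> grid (M k) (N k) \<Longrightarrow>
           distributed (P k) \<nu> (X k ij) (\<lambda>x. ennreal (tilt_density \<nu> (\<theta> k ij) x))"
    and "filterlim M at_top sequentially" and "filterlim N at_top sequentially"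
    and "filterlim m at_top sequentially" and "filterlim n at_top sequentially"
    and "(\<lambda>k. real (m k) / real (M k)) \<longlonglongrightarrow> 0"
    and "(\<lambda>k. real (n k) / real (N k)) \<longlonglongrightarrow> 0"
    and "(\<lambda>k. ln (real (max (M k) (N k))) / real (min (m k) (n k))) \<longlonglongrightarrow> 0"
    and "(\<lambda>k. (ln (real (max (M k) (N k)))) ^ 3 / real (min (m k) (n k))) \<longlonglongrightarrow> 0"
    and "bdd_above (measure_support \<nu>) \<or>
         (\<exists>\<theta>bar. ereal \<theta>bar < theta_star \<nu> \<and>
            (\<forall>k. \<forall>ij \<in> grid (M k) (N k). \<theta> k ij \<le> \<theta>bar))"
    and "G = row_perms \<or> G = all_perms"
    and "G = row_perms \<Longrightarrow> \<exists>t<0. mgf \<nu> t < \<infinity>"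
    and "liminf (\<lambda>k. ereal (\<theta>dd k * sqrt (real (m k * n k)) /
           sqrt (2 * (real (m k) * ln (real (M k) / real (m k)) +
                      real (n k) * ln (real (N k) / real (n k)))))) > 1"
    and "0 < \<alpha>"
  shows "(\<lambda>k. measure (P k)
            {\<omega> \<in> space (P k).
               perm_pvalue (G (M k) (N k)) (M k) (N k) (m k) (n k) (\<lambda>ij. X k ij \<omega>) \<le> \<alpha>})
         \<longlonglongrightarrow> 1"
proof -
  interpret real_distribution \<nu> by fact
  interpret standardized_distribution \<nu>
    by unfold_locales (use assms(2-5) in simp_all)
  interpret submatrix_scaling M N m n
    by unfold_locales (fact assms)+
  interpret P: prob_space "P k" for k by fact
  note m0 = assms(7) and mM = assms(8) and n0 = assms(9) and nN = assms(10)
  note I = assms(12,13) and J = assms(14,15) and \<theta> = assms(16) and \<theta>_signal = assms(17) and \<theta>_null = assms(18)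
  note indep = assms(20) and dist = assms(21) and bounded_case = assms(30) and G = assms(31) and \<alpha> = assms(34)

  have sub: "c \<in> grid (M k) (N k)" if "c \<in> Itrue k \<times> Jtrue k" for c k
    using that I(1)[of k] J(1)[of k] by (auto simp: grid_def)

  \<comment> \<open>For bounded support any real serves as \<open>\<theta>bar\<close>; this merges
    the two alternatives.\<close>
  have "\<exists>\<theta>bar. (bdd_above (measure_support \<nu>) \<or> ereal \<theta>bar < theta_star \<nu>) \<and>
      (\<forall>k. \<forall>c\<in>grid (M k) (N k). bdd_above (measure_support \<nu>) \<or> \<theta> k c \<le> \<theta>bar)"
    using bounded_case by (cases "bdd_above (measure_support \<nu>)") auto
  then obtain \<theta>bar where \<theta>bar: "bdd_above (measure_support \<nu>) \<or> ereal \<theta>bar < theta_star \<nu>"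
    "\<forall>k. \<forall>c\<in>grid (M k) (N k). bdd_above (measure_support \<nu>) \<or> \<theta> k c \<le> \<theta>bar"
    by (elim exE conjE)
  obtain d C0 where d: "0 < d" and C0:
    "\<forall>\<theta>. 0 \<le> \<theta> \<longrightarrow> ereal \<theta> < theta_star \<nu> \<longrightarrow> bdd_above (measure_support \<nu>) \<or> \<theta> \<le> \<theta>bar \<longrightarrow>
       integrable \<nu> (\<lambda>x. tilted_square d x * exp (\<theta> * x)) \<and>
       expectation (\<lambda>x. tilted_square d x * exp (\<theta> * x)) \<le> C0 * \<phi> \<theta>"
    using uniform_tilted_moment_bound[OF \<theta>bar(1)] by (elim exE conjE)
  \<comment> \<open>At least \<open>1\<close>, so that it can be divided by in \<open>s\<close> and
    in the bound for \<open>n / N\<close>.\<close>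
  define C where "C = max C0 1"
  have C: "1 \<le> C" "C0 \<le> C" by (auto simp: C_def)

  have exp_int: "integrable \<nu> (\<lambda>x. exp (\<theta> k c * x))" if "c \<in> grid (M k) (N k)" for k c
    using integrable_exp_below_theta_star[of "\<theta> k c"] \<theta>[OF that] by blast
  have sq_int: "integrable \<nu> (\<lambda>x. tilted_square d x * exp (\<theta> k c * x))"
    and sq_le: "expectation (\<lambda>x. tilted_square d x * exp (\<theta> k c * x)) \<le> C * \<phi> (\<theta> k c)"
    if c: "c \<in> grid (M k) (N k)" for k c
  proof -
    have "C0 * \<phi> (\<theta> k c) \<le> C * \<phi> (\<theta> k c)"
      using phi_ge_1[OF exp_int[OF c]] C by (intro mult_right_mono) auto
    then show "integrable \<nu> (\<lambda>x. tilted_square d x * exp (\<theta> k c * x))"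
      "expectation (\<lambda>x. tilted_square d x * exp (\<theta> k c * x)) \<le> C * \<phi> (\<theta> k c)"
      using C0[rule_format, of "\<theta> k c"] \<theta>[OF c] \<theta>bar(2)[rule_format, OF c] by auto
  qed

  \<comment> \<open>The untilted law is the case \<open>\<theta> = 0\<close>. This value is
    admissible because the parameter at the cell \<open>(1, 1)\<close> is both admissible and
    nonnegative.\<close>
  have d_int: "integrable \<nu> (tilted_square d)"
  proof -
    have c: "(1, 1) \<in> grid (M 0) (N 0)" using M_pos[of 0] N_pos[of 0] by (simp add: grid_def)
    have "0 \<le> \<theta> 0 (1, 1)" "ereal (\<theta> 0 (1, 1)) < theta_star \<nu>" using \<theta>[OF c] by auto
    moreover have "ereal 0 \<le> ereal (\<theta> 0 (1, 1))" using calculation by simp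
    ultimately have "ereal 0 < theta_star \<nu>" by (metis order.strict_trans1)
    moreover have "bdd_above (measure_support \<nu>) \<or> 0 \<le> \<theta>bar"
      using \<theta>bar(2)[rule_format, OF c] \<open>0 \<le> \<theta> 0 (1, 1)\<close> by auto
    ultimately show ?thesis using C0[rule_format, of 0] by simp
  qed

  \<comment> \<open>\<open>\<rho>\<close> lies strictly between \<open>1\<close> and the lower
    limit; the quotient inside that limit is \<open>\<theta>dd / \<tau>\<close>.\<close>
  obtain \<rho> :: real where \<rho>: "1 < \<rho>" and signal: "eventually (\<lambda>k. \<rho> * \<tau> k \<le> \<theta>dd k) sequentially"
  proof -
    obtain \<rho> where \<rho>: "1 < ereal \<rho>" "ereal \<rho> < liminf (\<lambda>k. ereal (\<theta>dd k * sqrt (real (m k * n k)) /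
           sqrt (2 * (real (m k) * ln (real (M k) / real (m k)) +
                      real (n k) * ln (real (N k) / real (n k))))))"
      using ereal_dense2[OF assms(33)] by blast
    have "eventually (\<lambda>k. \<rho> * \<tau> k \<le> \<theta>dd k) sequentially"
      using less_LiminfD[OF \<rho>(2)] eventually_tau_pos
    proof eventually_elim
      case (elim k)
      have mn: "sqrt (real (m k * n k)) > 0" using m0 n0 by simp
      have "\<tau> k = sqrt (2 * log_count k) / sqrt (real (m k * n k))"
        by (simp add: \<tau>_def real_sqrt_divide)
      moreover have "\<rho> < \<theta>dd k * sqrt (real (m k * n k)) / sqrt (2 * log_count k)"
        using elim(1) by (simp add: log_count_def)
      ultimately show ?case using elim(2) mn
        by (simp add: field_simps zero_less_divide_iff)
    qed
    then show ?thesis using that[of \<rho>] \<rho>(1) by (simp add: one_ereal_def)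
  qed

  \<comment> \<open>\<open>b\<close> is midway between \<open>1\<close> and \<open>\<rho>\<close>,
    because the tilted mean at \<open>\<rho> * \<tau>\<close> is only asymptotically
    \<open>\<rho> * \<tau>\<close>. The excess of \<open>b\<close> is divided into \<open>16\<close>
    units \<open>e\<close>, from which all errors in the exponent are paid.\<close>
  define b where "b = (1 + \<rho>) / 2"
  define e where "e = (b - 1) / 16"
  have b: "1 < b" and e: "0 < e" and b_e: "b = 1 + 16 * e" using \<rho> by (auto simp: b_def e_def field_simps)
  define s where "s = min 1 (e / (4 * C))"
  have s: "0 < s" "s \<le> 1" "4 * s * C \<le> e"
    using e C by (auto simp: s_def min_def field_simps)

  define p where "p k = real (M k * N k) * (C * exp (- d / \<tau> k))
      + real (M k choose m k) * exp (- s * e * (real (m k) * real (N k) * (\<tau> k)\<^sup>2))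
      + sqrt (C * real (n k)) / (e * real (N k) * \<tau> k)
      + C / (e\<^sup>2 * (real (m k) * real (n k) * (\<tau> k)\<^sup>2))" for k
  have p: "(\<lambda>k. 1 - p k) \<longlonglongrightarrow> 1"
  proof -
    have "p \<longlonglongrightarrow> 0 + 0 + 0 + 0"
      unfolding p_def using s e d C
      by (intro tendsto_add entries_tail blocks_tail[of "s * e", folded mult_minus_left] rows_tail chebyshev_tail) auto
    then have "(\<lambda>k. 1 - p k) \<longlonglongrightarrow> 1 - 0" by (intro tendsto_diff tendsto_const) simp
    then show ?thesis by simp
  qed

  let ?A = "\<lambda>k. {\<omega> \<in> space (P k). perm_pvalue (G (M k) (N k)) (M k) (N k) (m k) (n k) (\<lambda>ij. X k ij \<omega>) \<le> \<alpha>}"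
  have X_meas: "X k c \<in> borel_measurable (P k)" if "c \<in> grid (M k) (N k)" for k c
    using indep[of k] that by (auto simp: P.indep_vars_def)
  have A_sets: "?A k \<in> sets (P k)" for k
  proof -
    have "(\<lambda>\<omega>. perm_pvalue (G (M k) (N k)) (M k) (N k) (m k) (n k) (\<lambda>c. X k c \<omega>)) \<in> borel_measurable (P k)"
      by (rule borel_measurable_perm_pvalue) (use X_meas perms_subset_all_perms[OF G] in auto)
    then show ?thesis by measurable
  qed

  have phi_small: "eventually (\<lambda>k. \<phi> (\<tau> k) - 1 \<le> (1 / 2 + e) * (\<tau> k)\<^sup>2) sequentially"
    using eventually_compose_filterlim[OF eventually_phi_le[OF d d_int e] tau_at_right[OF zero_less_one]] by simp
  \<comment> \<open>The ratio \<open>b / \<rho>\<close> is below \<open>1\<close>, as the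
    asymptotics of the tilted mean require.\<close>
  have mean_large: "eventually (\<lambda>k. integrable \<nu> (\<lambda>x. x * exp (\<rho> * \<tau> k * x)) \<and>
      b / \<rho> * (\<rho> * \<tau> k) * \<phi> (\<rho> * \<tau> k) \<le> expectation (\<lambda>x. x * exp (\<rho> * \<tau> k * x))) sequentially"
  proof -
    have "0 < \<rho>" "b / \<rho> < 1" using \<rho> by (auto simp: b_def field_simps)
    then show ?thesis
      using eventually_compose_filterlim[OF eventually_tilted_mean_ge[OF d d_int] tau_at_right] by blast
  qed
  have tau_small: "eventually (\<lambda>k. \<tau> k < min 1 (d / 2)) sequentially"
    using tau_zero d by (intro order_tendstoD) auto
  have ratio_small: "eventually (\<lambda>k. real (n k) / real (N k) < min (e / C) (e / b)) sequentially"
    using e C b by (intro eventually_n_small) auto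
  have sizes: "eventually (\<lambda>k. real (m k) + real (n k) \<le> 2 * e * log_count k) sequentially"
    using e by (intro eventually_sizes_le_log_count) auto
  have level: "eventually (\<lambda>k. exp (- (16 * e * log_count k)) < \<alpha>) sequentially"
    using exp_minus_log_count[of "16 * e"] e \<alpha> by (intro order_tendstoD) auto

  have "eventually (\<lambda>k. 1 - p k \<le> P.prob k (?A k)) sequentially"
    using signal eventually_tau_pos phi_small mean_large tau_small ratio_small sizes level
  proof eventually_elim
    case (elim k)
    interpret S: submatrix_sample "P k" "X k" "M k" "N k" "m k" "n k" "Itrue k" "Jtrue k" "\<tau> k" d C
    proof unfold_locales
      fix c assume c: "c \<in> grid (M k) (N k)"
      note D = distributed_tilt[OF dist[OF c] exp_int[OF c] borel_measurable_tilted_square]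
      show "integrable (P k) (\<lambda>\<omega>. tilted_square d (X k c \<omega>))" using D(1) sq_int[OF c] by simp
      show "P.expectation k (\<lambda>\<omega>. tilted_square d (X k c \<omega>)) \<le> C"
        using D(2) sq_le[OF c] phi_ge_1[OF exp_int[OF c]] by (simp add: pos_divide_le_eq)
    qed (use indep I J m0 n0 elim in auto)
    have null: "P.expectation k (S.V c) \<le> (1 / 2 + e) * (\<tau> k)\<^sup>2"
      if c: "c \<in> grid (M k) (N k) - Itrue k \<times> Jtrue k" for c
    proof -
      have c': "c \<in> grid (M k) (N k)" using c by simp
      have "integrable (P k) (\<lambda>\<omega>. exp (\<tau> k * X k c \<omega>))" "P.expectation k (\<lambda>\<omega>. exp (\<tau> k * X k c \<omega>)) = \<phi> (\<tau> k)"
        using distributed_tilt[OF dist[OF c'] exp_int[OF c'], of "\<lambda>x. exp (\<tau> k * x)"] \<theta>_null[OF c]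
          integrable_exp_of_tilted_square[OF d d_int, of "\<tau> k"] elim(2,5) by auto
      then have "P.expectation k (S.V c) = \<phi> (\<tau> k) - 1"
        unfolding S.V_def by (simp add: P.prob_space)
      then show ?thesis using elim(3) by simp
    qed
    \<comment> \<open>The mean bound at tilt \<open>\<rho> * \<tau>\<close> carries over to the
      larger \<open>\<theta>\<close> by \<open>tilted_mean_mono\<close>.\<close>
    have alt: "b * \<tau> k \<le> P.expectation k (X k c)" if c: "c \<in> Itrue k \<times> Jtrue k" for c
    proof -
      note c' = sub[OF c]
      have le: "\<rho> * \<tau> k \<le> \<theta> k c" using elim(1) \<theta>_signal[OF c] by linarith
      have int_exp: "integrable \<nu> (\<lambda>x. exp (\<rho> * \<tau> k * x))"
        using integrable_exp_mono[OF exp_int[OF c'] _ le] \<rho> elim(2) by simp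
      have "b * \<tau> k * \<phi> (\<theta> k c) \<le> expectation (\<lambda>x. x * exp (\<theta> k c * x))"
        by (rule tilted_mean_mono[OF le int_exp _ exp_int[OF c'] integrable_mult_exp[OF exp_int[OF c'] sq_int[OF c'] less_imp_le[OF d]]])
           (use elim(4) \<rho> in auto)
      then have "b * \<tau> k \<le> expectation (\<lambda>x. x * exp (\<theta> k c * x)) / \<phi> (\<theta> k c)"
        using phi_ge_1[OF exp_int[OF c']] by (simp add: pos_le_divide_eq)
      also have "\<dots> = P.expectation k (X k c)"
        using distributed_tilt(2)[OF dist[OF c'] exp_int[OF c'], of "\<lambda>x. x"] by simp
      finally show ?thesis .
    qed
    define r where "r = real (n k) / real (N k)"
    define Q where "Q = real (m k) * real (n k) * ((\<tau> k)\<^sup>2 * (1 / 2 + e + 4 * e + C * r) - \<tau> k * (b * \<tau> k) * (1 - r))"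
    have "1 - p k \<le> P.prob k {\<omega> \<in> space (P k). perm_pvalue (G (M k) (N k)) (M k) (N k) (m k) (n k) (\<lambda>c. X k c \<omega>) \<le>
        real (M k choose m k) * real (N k choose n k) * exp Q}"
      unfolding p_def Q_def r_def
      by (rule S.prob_perm_pvalue_le[OF G s e _ null alt]) (use e b elim(2) in auto)
    also have "\<dots> \<le> P.prob k (?A k)"
    proof (rule P.finite_measure_mono[OF _ A_sets])
      have r: "C * r \<le> e" "b * r \<le> e" using elim(6) C b by (auto simp: r_def field_simps)
      \<comment> \<open>The bracket is at most \<open>1 / 2 + 5 * e + e - b + e\<close>, which with
        \<open>b = 1 + 16 * e\<close> equals \<open>- 1 / 2 - 9 * e\<close>. Doubled, this is
        \<open>- 1 - 18 * e\<close>: the \<open>- 1\<close> cancels the leading count of blocks, and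
        \<open>m + n\<close> takes at most \<open>2 * e\<close>.\<close>
      have "Q = 2 * log_count k * (1 / 2 + e + 4 * e + C * r - b * (1 - r))"
        unfolding Q_def mn_tau_square[symmetric] by (simp add: power2_eq_square algebra_simps)
      also have "\<dots> \<le> 2 * log_count k * (- 1 / 2 - 9 * e)"
        using r b_e log_count_nonneg[of k] by (intro mult_left_mono) (auto simp: algebra_simps)
      finally have Q: "Q \<le> - log_count k - 18 * e * log_count k" by (simp add: algebra_simps)
      have "real (M k choose m k) * real (N k choose n k) * exp Q
          \<le> exp (log_count k + real (m k) + real (n k)) * exp Q"
        by (intro mult_right_mono choose_le) auto
      also have "\<dots> \<le> exp (- (16 * e * log_count k))"
        using Q elim(7) by (simp flip: exp_add)
      also have "\<dots> \<le> \<alpha>" using elim(8) by simp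
      finally have "real (M k choose m k) * real (N k choose n k) * exp Q \<le> \<alpha>" .
      then show "{\<omega> \<in> space (P k). perm_pvalue (G (M k) (N k)) (M k) (N k) (m k) (n k) (\<lambda>c. X k c \<omega>) \<le>
        real (M k choose m k) * real (N k choose n k) * exp Q} \<subseteq> ?A k" by auto
    qed
    finally show ?case .
  qed
  then show ?thesis
    by (intro tendsto_sandwich[OF _ _ p tendsto_const]) auto
qed

end
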